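(* Let $\mathbb{F}$ be an algebraically closed field of characteristic $p\ge 0$ and let $A$ be an infinite (countable) dimensional simple locally finite associative algebra over $\mathbb{F}$. Then $A$ has a $1$-perfect conical local system, i.e. a conical local system all of whose members are $1$-perfect algebras.
   Context: Algebras are associative and not required to have an identity element; ideals are two-sided. An algebra $A$ over $\mathbb{F}$ is locally finite if every finite set of elements of $A$ is contained in a finite dimensional subalgebra of $A$. A local system for $A$ is a system $\{A_\alpha\}_{\alpha\in\Gamma}$ of finite dimensional subalgebras of $A$ such that $A=\bigcup_{\alpha\in\Gamma}A_\alpha$ and for all $\alpha,\beta\in\Gamma$ there is $\gamma\in\Gamma$ with $A_\alpha,A_\beta\subseteq A_\gamma$; one writes $\alpha\le\beta$ if $A_\alpha\subseteq A_\beta$. An algebra $B$ is perfect if $BB=B$ ($BB$ being the linear span of all products of two elements of $B$); a local system is perfect if all its members are perfect. An associative algebra is $1$-perfect if it has no ideals of codimension $1$; a local system is $1$-perfect if all its members are $1$-perfect. For a finite dimensional perfect algebra $B$ with (nilpotent) radical $\operatorname{rad}B$, write $B/\operatorname{rad}B=S_1\oplus\dots\oplus S_n$ with simple components $S_i\cong M_{n_i}(\mathbb{F})$. A natural $B$-module is a module obtained from the natural $n_i$-dimensional module $\mathbb{F}^{n_i}$ of some $S_i$ by letting $B$ act through the projection $B\to B/\operatorname{rad}B\to S_i$. A perfect local system $\{A_\alpha\}_{\alpha\in\Gamma}$ of $A$ is conical if $\Gamma$ contains a minimal element $1$ such that: (1) $A_1\subseteq A_\alpha$ for all $\alpha\in\Gamma$;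 (2) $A_1$ is simple; (3) for each $\alpha\in\Gamma$ the restriction of any natural $A_\alpha$-module to $A_1$ has a non-trivial composition factor (i.e. a composition factor on which $A_1$ does not act as zero). *)

theory Defs
  imports "HOL-Algebra.QuotRing" "HOL-Library.Countable_Set" "HOL-Computational_Algebra.Polynomial"
    "Jordan_Normal_Form.Matrix"
begin

section \<open>Algebras given by a carrier\<close>

text \<open>
  Quotients, their simple components and the matrix algebras live on different types. They are
  all presented as \<^type>\<open>module\<close> records. Algebras are not assumed to be
  unital: the field \<^const>\<open>one\<close> of the record is never used.
\<close>

definition alg_ideal :: "'v set \<Rightarrow> ('f, 'v) module \<Rightarrow> bool" where
  "alg_ideal I M \<longleftrightarrow> I \<subseteq> carrier M \<and> \<zero>\<^bsub>M\<^esub> \<in> I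
     \<and> (\<forall>x\<in>I. \<forall>y\<in>I. x \<oplus>\<^bsub>M\<^esub> y \<in> I)
     \<and> (\<forall>c. \<forall>x\<in>I. c \<odot>\<^bsub>M\<^esub> x \<in> I)
     \<and> (\<forall>x\<in>I. \<forall>b\<in>carrier M. x \<otimes>\<^bsub>M\<^esub> b \<in> I \<and> b \<otimes>\<^bsub>M\<^esub> x \<in> I)"

text \<open>As usual for algebras without identity, a simple algebra has non-zero multiplication.\<close>

definition simple_algebra :: "('f, 'v) module \<Rightarrow> bool" where
  "simple_algebra M \<longleftrightarrow>
     (\<exists>x\<in>carrier M. \<exists>y\<in>carrier M. x \<otimes>\<^bsub>M\<^esub> y \<noteq> \<zero>\<^bsub>M\<^esub>)
     \<and> (\<forall>I. alg_ideal I M \<longrightarrow> I = {\<zero>\<^bsub>M\<^esub>} \<or> I = carrier M)"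

definition alg_iso :: "('v \<Rightarrow> 'w) \<Rightarrow> ('f, 'v) module \<Rightarrow> ('f, 'w) module \<Rightarrow> bool" where
  "alg_iso \<phi> M N \<longleftrightarrow> bij_betw \<phi> (carrier M) (carrier N)
     \<and> (\<forall>x\<in>carrier M. \<forall>y\<in>carrier M.
          \<phi> (x \<oplus>\<^bsub>M\<^esub> y) = \<phi> x \<oplus>\<^bsub>N\<^esub> \<phi> y \<and> \<phi> (x \<otimes>\<^bsub>M\<^esub> y) = \<phi> x \<otimes>\<^bsub>N\<^esub> \<phi> y)
     \<and> (\<forall>c. \<forall>x\<in>carrier M. \<phi> (c \<odot>\<^bsub>M\<^esub> x) = c \<odot>\<^bsub>N\<^esub> \<phi> x)"

text \<open>This is \<^const>\<open>FactRing\<close>, with the induced scalar multiplication added.\<close>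

definition quotient_alg :: "('f, 'v) module \<Rightarrow> 'v set \<Rightarrow> ('f, 'v set) module" where
  "quotient_alg M I =
     \<lparr>carrier = a_rcosets\<^bsub>M\<^esub> I, monoid.mult = rcoset_mult M I, one = undefined,
      zero = I, add = set_add M,
      smult = (\<lambda>c X. \<Union>x\<in>X. I +>\<^bsub>M\<^esub> (c \<odot>\<^bsub>M\<^esub> x))\<rparr>"

definition direct_sum_of_ideals :: "('f, 'v) module \<Rightarrow> nat \<Rightarrow> (nat \<Rightarrow> 'v set) \<Rightarrow> bool" where
  "direct_sum_of_ideals M k S \<longleftrightarrow> (\<forall>j<k. alg_ideal (S j) M)
     \<and> (\<forall>x\<in>carrier M. \<exists>!s. s \<in> (\<Pi>\<^sub>E j\<in>{..<k}. S j) \<and> x = (\<Oplus>\<^bsub>M\<^esub>j\<in>{..<k}. s j))"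

definition summand_proj :: "('f, 'v) module \<Rightarrow> nat \<Rightarrow> (nat \<Rightarrow> 'v set) \<Rightarrow> nat \<Rightarrow> 'v \<Rightarrow> 'v" where
  "summand_proj M k S i x =
     (THE s. s \<in> (\<Pi>\<^sub>E j\<in>{..<k}. S j) \<and> x = (\<Oplus>\<^bsub>M\<^esub>j\<in>{..<k}. s j)) i"

definition simple_components :: "('f, 'v) module \<Rightarrow> nat \<Rightarrow> (nat \<Rightarrow> 'v set) \<Rightarrow> bool" where
  "simple_components M k S \<longleftrightarrow>
     direct_sum_of_ideals M k S \<and> (\<forall>j<k. simple_algebra (M\<lparr>carrier := S j\<rparr>))"


section \<open>Composition factors of modules on column vectors\<close>

text \<open>
  A representation \<open>\<rho>\<close> of a set \<open>C\<close> of algebra elements by \<open>n \<times> n\<close> matrices makes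
  \<open>carrier_vec n\<close> a module; only the values of \<open>\<rho>\<close> on \<open>C\<close> matter, so restricting
  the module to a subalgebra amounts to shrinking \<open>C\<close>.
\<close>

definition rep_submodule ::
    "'a set \<Rightarrow> nat \<Rightarrow> ('a \<Rightarrow> 'f::field mat) \<Rightarrow> 'f vec set \<Rightarrow> bool" where
  "rep_submodule C n \<rho> U \<longleftrightarrow> U \<subseteq> carrier_vec n \<and> 0\<^sub>v n \<in> U
     \<and> (\<forall>u\<in>U. \<forall>v\<in>U. u + v \<in> U) \<and> (\<forall>c. \<forall>u\<in>U. c \<cdot>\<^sub>v u \<in> U)
     \<and> (\<forall>a\<in>C. \<forall>u\<in>U. \<rho> a *\<^sub>v u \<in> U)"

definition composition_series ::
    "'a set \<Rightarrow> nat \<Rightarrow> ('a \<Rightarrow> 'f::field mat) \<Rightarrow> nat \<Rightarrow> (nat \<Rightarrow> 'f vec set) \<Rightarrow> bool" where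
  "composition_series C n \<rho> m V \<longleftrightarrow> V 0 = {0\<^sub>v n} \<and> V m = carrier_vec n
     \<and> (\<forall>j\<le>m. rep_submodule C n \<rho> (V j))
     \<and> (\<forall>j<m. V j \<subset> V (Suc j)
          \<and> (\<forall>U. rep_submodule C n \<rho> U \<and> V j \<subseteq> U \<and> U \<subseteq> V (Suc j)
                 \<longrightarrow> U = V j \<or> U = V (Suc j)))"

text \<open>
  \<open>C\<close> acts as zero on the factor \<open>V (Suc j) / V j\<close> iff it maps \<open>V (Suc j)\<close> into \<open>V j\<close>.
\<close>

definition has_nontrivial_composition_factor ::
    "'a set \<Rightarrow> nat \<Rightarrow> ('a \<Rightarrow> 'f::field mat) \<Rightarrow> bool" where
  "has_nontrivial_composition_factor C n \<rho> \<longleftrightarrow>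
     (\<exists>m V. composition_series C n \<rho> m V
        \<and> (\<exists>j<m. \<exists>a\<in>C. \<exists>w\<in>V (Suc j). \<rho> a *\<^sub>v w \<notin> V j))"


section \<open>Associative algebras and local systems\<close>

text \<open>The class \<^class>\<open>ring\<close> does not require an identity element.\<close>

locale assoc_algebra = vector_space scale
  for scale :: "'f::field \<Rightarrow> 'a::ring \<Rightarrow> 'a" (infixr \<open>*s\<close> 75) +
  assumes scale_mult_left: "(c *s x) * y = c *s (x * y)"
    and scale_mult_right: "x * (c *s y) = c *s (x * y)"
begin

definition alg_on :: "'a set \<Rightarrow> ('f, 'a) module" where
  "alg_on B = \<lparr>carrier = B, monoid.mult = (*), one = undefined, zero = 0, add = (+), smult = (*s)\<rparr>"

definition subalgebra :: "'a set \<Rightarrow> bool" where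
  "subalgebra B \<longleftrightarrow> subspace B \<and> (\<forall>x\<in>B. \<forall>y\<in>B. x * y \<in> B)"

definition fin_dim :: "'a set \<Rightarrow> bool" where
  "fin_dim B \<longleftrightarrow> (\<exists>X. finite X \<and> span X = B)"

definition countably_infinite_dimensional :: bool where
  "countably_infinite_dimensional \<longleftrightarrow>
     (\<exists>X. independent X \<and> span X = UNIV \<and> infinite X \<and> countable X)"

definition locally_finite :: bool where
  "locally_finite \<longleftrightarrow> (\<forall>X. finite X \<longrightarrow> (\<exists>B. subalgebra B \<and> fin_dim B \<and> X \<subseteq> B))"

definition set_prod :: "'a set \<Rightarrow> 'a set \<Rightarrow> 'a set" where
  "set_prod X Y = span {x * y | x y. x \<in> X \<and> y \<in> Y}"

definition perfect :: "'a set \<Rightarrow> bool" where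
  "perfect B \<longleftrightarrow> set_prod B B = B"

text \<open>The set \<open>X\<close> below represents a basis of the quotient space \<open>B / I\<close>.\<close>

definition has_codim :: "'a set \<Rightarrow> 'a set \<Rightarrow> nat \<Rightarrow> bool" where
  "has_codim I B d \<longleftrightarrow> (\<exists>X. finite X \<and> card X = d \<and> independent X
     \<and> I \<inter> span X = {0} \<and> span (I \<union> X) = B)"

definition one_perfect :: "'a set \<Rightarrow> bool" where
  "one_perfect B \<longleftrightarrow> \<not> (\<exists>I. alg_ideal I (alg_on B) \<and> has_codim I B 1)"

text \<open>\<open>set_power I m\<close> is the power \<open>I\<^sup>m\<^sup>+\<^sup>1\<close>.\<close>

primrec set_power :: "'a set \<Rightarrow> nat \<Rightarrow> 'a set" where
  "set_power I 0 = I"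
| "set_power I (Suc m) = set_prod I (set_power I m)"

definition nilpotent :: "'a set \<Rightarrow> bool" where
  "nilpotent I \<longleftrightarrow> (\<exists>m. set_power I m = {0})"

text \<open>The sum of all nilpotent ideals, which for finite dimensional \<open>B\<close> is the largest one.\<close>

definition rad :: "'a set \<Rightarrow> 'a set" where
  "rad B = span (\<Union>{I. alg_ideal I (alg_on B) \<and> nilpotent I})"

text \<open>
  \<open>natural_rep B n \<rho>\<close>: the matrices \<open>\<rho> b\<close> describe the action of \<open>b \<in> B\<close> on the natural
  module of a simple component \<open>S i \<cong> M\<^sub>n(F)\<close> of \<open>B / rad B\<close>.
\<close>

definition natural_rep :: "'a set \<Rightarrow> nat \<Rightarrow> ('a \<Rightarrow> 'f mat) \<Rightarrow> bool" where
  "natural_rep B n \<rho> \<longleftrightarrow>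
     (\<exists>Q k S i \<phi>. Q = quotient_alg (alg_on B) (rad B)
        \<and> simple_components Q k S \<and> i < k
        \<and> alg_iso \<phi> (Q\<lparr>carrier := S i\<rparr>) (module_mat TYPE('f) n n)
        \<and> (\<forall>b\<in>B. \<rho> b = \<phi> (summand_proj Q k S i (rad B +>\<^bsub>alg_on B\<^esub> b))))"

definition local_system :: "'i set \<Rightarrow> ('i \<Rightarrow> 'a set) \<Rightarrow> bool" where
  "local_system \<Gamma> L \<longleftrightarrow> (\<forall>\<alpha>\<in>\<Gamma>. subalgebra (L \<alpha>) \<and> fin_dim (L \<alpha>))
     \<and> (\<Union>\<alpha>\<in>\<Gamma>. L \<alpha>) = UNIV
     \<and> (\<forall>\<alpha>\<in>\<Gamma>. \<forall>\<beta>\<in>\<Gamma>. \<exists>\<gamma>\<in>\<Gamma>. L \<alpha> \<subseteq> L \<gamma> \<and> L \<beta> \<subseteq> L \<gamma>)"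

definition perfect_local_system :: "'i set \<Rightarrow> ('i \<Rightarrow> 'a set) \<Rightarrow> bool" where
  "perfect_local_system \<Gamma> L \<longleftrightarrow> local_system \<Gamma> L \<and> (\<forall>\<alpha>\<in>\<Gamma>. perfect (L \<alpha>))"

definition one_perfect_local_system :: "'i set \<Rightarrow> ('i \<Rightarrow> 'a set) \<Rightarrow> bool" where
  "one_perfect_local_system \<Gamma> L \<longleftrightarrow> local_system \<Gamma> L \<and> (\<forall>\<alpha>\<in>\<Gamma>. one_perfect (L \<alpha>))"

text \<open>
  Minimality of \<open>\<alpha>\<^sub>1\<close> is already implied by its being below every index, so it is not
  listed separately.
\<close>

definition conical_local_system :: "'i set \<Rightarrow> ('i \<Rightarrow> 'a set) \<Rightarrow> bool" where
  "conical_local_system \<Gamma> L \<longleftrightarrow> perfect_local_system \<Gamma> L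
     \<and> (\<exists>\<alpha>\<^sub>1\<in>\<Gamma>. (\<forall>\<alpha>\<in>\<Gamma>. L \<alpha>\<^sub>1 \<subseteq> L \<alpha>)
          \<and> simple_algebra (alg_on (L \<alpha>\<^sub>1))
          \<and> (\<forall>\<alpha>\<in>\<Gamma>. \<forall>n \<rho>. natural_rep (L \<alpha>) n \<rho>
                \<longrightarrow> has_nontrivial_composition_factor (L \<alpha>\<^sub>1) n \<rho>))"

end

end

theory Submission
  imports Defs
begin

text \<open>
  If \<open>x \<noteq> 0\<close> and \<open>x\<^sup>2 = 0\<close>, then \<open>x A\<close> is not nil, by Nakayama's lemma and \<open>A = A x A x A\<close>, so it
  contains an idempotent \<open>x s \<noteq> 0\<close>, from which \<open>2 \<times> 2\<close> matrix units are built. If there is no such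
  \<open>x\<close>, then \<open>A\<close> is an algebraic domain over an algebraically closed field, hence one-dimensional,
  which is excluded.

  Let \<open>S \<cong> M\<^sub>2(F)\<close> be spanned by matrix units \<open>e = u v, u, v, v u\<close> in \<open>A\<close>. The finite dimensional
  subalgebras \<open>C \<supseteq> S\<close> with \<open>C = C e C\<close> form the required local system, with least member \<open>S\<close>: they
  exhaust \<open>A = A e A\<close>, since every finite dimensional subalgebra \<open>B \<supseteq> S\<close> gives the member
  \<open>B e B\<close>. An ideal of codimension one in \<open>C\<close> contains \<open>e\<close>, hence is all of \<open>C\<close>. The idempotent
  \<open>e\<close> acts on a natural \<open>C\<close>-module as a non-zero idempotent, as otherwise \<open>C = C e C\<close> would act as
  zero, and so it acts non-trivially on some composition factor of the restriction to \<open>S\<close>.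
\<close>

section \<open>Idempotents and matrix units in locally finite algebras\<close>

context assoc_algebra
begin

section \<open>Subalgebras, and evaluation of polynomials without constant term\<close>

lemma mult_in_subalgebra: "subalgebra B \<Longrightarrow> x \<in> B \<Longrightarrow> y \<in> B \<Longrightarrow> x * y \<in> B"
  by (simp add: subalgebra_def)

lemma subspace_subalgebra: "subalgebra B \<Longrightarrow> subspace B"
  by (simp add: subalgebra_def)

lemma finite_dim_subspace:
  assumes "subspace B" "B \<subseteq> span X" "finite X"
  shows "fin_dim B"
proof -
  obtain Y where Y: "Y \<subseteq> B" "independent Y" "B \<subseteq> span Y"
    using maximal_independent_subset by blast
  have "finite Y"
    using independent_span_bound[OF assms(3) Y(2)] Y(1) assms(2) by auto
  moreover have "span Y = B"
    using span_minimal[OF Y(1) assms(1)] Y(3) by auto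
  ultimately show ?thesis unfolding fin_dim_def by blast
qed

text \<open>
  Since there is no identity element, polynomials cannot be evaluated at \<open>a\<close>; they act on
  the algebra through the left multiplication by \<open>a\<close> instead.
\<close>

definition poly_act :: "'a \<Rightarrow> 'f poly \<Rightarrow> 'a \<Rightarrow> 'a" where
  "poly_act a p x = fold_coeffs (\<lambda>c r. c *s x + a * r) p 0"

lemma poly_act_0 [simp]: "poly_act a 0 x = 0"
  by (simp add: poly_act_def)

lemma poly_act_pCons [simp]: "poly_act a (pCons c p) x = c *s x + a * poly_act a p x"
  by (cases "p = 0 \<and> c = 0") (auto simp: poly_act_def)

lemma poly_act_1 [simp]: "poly_act a 1 x = x"
  by (simp add: one_pCons)

lemma poly_act_add: "poly_act a (p + q) x = poly_act a p x + poly_act a q x"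
  by (induction p q rule: poly_induct2) (simp_all add: algebra_simps scale_left_distrib)

lemma poly_act_smult: "poly_act a (Polynomial.smult c p) x = c *s poly_act a p x"
  by (induction p) (simp_all add: scale_right_distrib scale_mult_right)

lemma poly_act_sum: "poly_act a (sum f I) x = (\<Sum>i\<in>I. poly_act a (f i) x)"
  by (induction I rule: infinite_finite_induct) (simp_all add: poly_act_add)

lemma poly_act_minus: "poly_act a (- p) x = - poly_act a p x"
  using poly_act_smult[of a "-1" p x] by simp

lemma poly_act_diff: "poly_act a (p - q) x = poly_act a p x - poly_act a q x"
  using poly_act_add[of a p "- q" x] by (simp add: poly_act_minus)

lemma poly_act_mult: "poly_act a (p * q) x = poly_act a p (poly_act a q x)"
  by (induction p) (simp_all add: poly_act_add poly_act_smult)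

lemma poly_act_zero_right [simp]: "poly_act a p 0 = 0"
  by (induction p) simp_all

lemma poly_act_mult_right: "poly_act a p (x * y) = poly_act a p x * y"
  by (induction p) (simp_all add: algebra_simps scale_mult_left)

lemma poly_act_X_power: "poly_act a ([:0, 1:] ^ n) x = ((*) a ^^ n) x"
  by (induction n) (simp_all add: poly_act_mult)

text \<open>\<open>poly_act a p a\<close> is the value at \<open>a\<close> of X p, so these are the
  values of the polynomials without constant term, and (X p)(X q) = X (p X q).\<close>

lemma poly_act_self_mult:
  "poly_act a p a * poly_act a q a = poly_act a (p * [:0, 1:] * q) a"
  by (simp only: poly_act_mult poly_act_mult_right[symmetric]) simp

lemma poly_act_in_subalgebra:
  assumes "subalgebra B" "a \<in> B"
  shows "poly_act a p a \<in> B"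
  using assms
  by (induction p)
    (auto intro!: subspace_add subspace_scale mult_in_subalgebra intro: subspace_subalgebra
      simp: subspace_0[OF subspace_subalgebra])

text \<open>The first \<open>card X + 1\<close> powers of \<open>a\<close> lie in a space spanned by
  \<open>card X\<close> vectors, so they satisfy a nontrivial linear relation.\<close>

lemma annihilating_poly:
  assumes B: "subalgebra B" "fin_dim B" "a \<in> B"
  shows "\<exists>p. p \<noteq> 0 \<and> poly_act a p a = 0"
proof -
  obtain X where X: "finite X" "span X = B" using B(2) by (auto simp: fin_dim_def)
  define N where "N = card X"
  define f where "f i = poly_act a (monom 1 i) a" for i
  show ?thesis
  \<comment> \<open>\<open>dependent\<close> speaks of the set of values, which hides repetitions;
    two equal powers are therefore treated apart and give a difference of monomials.\<close>
  proof (cases "inj_on f {..N}")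
    case False
    then obtain i j where ij: "i \<noteq> j" "f i = f j" by (auto simp: inj_on_def)
    have "monom 1 i - monom 1 j \<noteq> (0::'f poly)"
      using ij(1) by (metis coeff_0 coeff_diff coeff_monom diff_zero zero_neq_one)
    then show ?thesis using ij(2)
      by (intro exI[of _ "monom 1 i - monom 1 j"]) (simp add: poly_act_diff f_def)
  next
    case True
    have "f ` {..N} \<subseteq> span X"
      using X(2) poly_act_in_subalgebra[OF B(1,3)] by (auto simp: f_def)
    moreover have "card (f ` {..N}) > card X" using True by (simp add: card_image N_def)
    ultimately have "dependent (f ` {..N})"
      using independent_span_bound[OF X(1)] by (meson not_le)
    then obtain u where u: "\<exists>v\<in>f ` {..N}. u v \<noteq> 0" "(\<Sum>v\<in>f ` {..N}. u v *s v) = 0"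
      using dependent_finite[of "f ` {..N}"] by auto
    define p where "p = (\<Sum>i\<le>N. Polynomial.smult (u (f i)) (monom 1 i))"
    have "poly_act a p a = (\<Sum>i\<le>N. u (f i) *s f i)"
      by (simp only: p_def poly_act_sum poly_act_smult f_def)
    also have "\<dots> = 0" using u(2) True by (simp add: sum.reindex)
    finally have 1: "poly_act a p a = 0" .
    obtain i where i: "i \<le> N" "u (f i) \<noteq> 0" using u(1) by auto
    have "coeff p i = u (f i)"
      using i(1) by (simp add: p_def coeff_sum smult_monom sum.delta)
    then have "p \<noteq> 0" using i(2) by auto
    then show ?thesis using 1 by blast
  qed
qed

text \<open>The iterate is the power a^(n+1); in the absence of an identity, the iteration of left
  multiplication starts at \<open>a\<close> itself.\<close>

definition nilp :: "'a \<Rightarrow> bool" where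
  "nilp a \<longleftrightarrow> (\<exists>n. ((*) a ^^ n) a = 0)"

text \<open>
  A polynomial annihilating \<open>a\<close> has the form \<open>c X\<^sup>m (1 - X w)\<close>, so \<open>X w\<close> acts as the
  identity on the multiples of \<open>X\<^sup>m\<close>. Hence \<open>(X w)\<^sup>m\<^sup>+\<^sup>1\<close> evaluates to an idempotent, which is
  zero only if \<open>a\<close> is nilpotent.
\<close>

lemma idempotent_multiple:
  assumes B: "subalgebra B" "fin_dim B" "a \<in> B" and nn: "\<not> nilp a"
  shows "\<exists>t. a * t \<noteq> 0 \<and> (a * t) * (a * t) = a * t"
proof -
  obtain p where p: "p \<noteq> 0" "poly_act a p a = 0" using annihilating_poly[OF B] by blast
  define X where "X = [:0, 1::'f:]"
  define P where "P q = poly_act a q a" for q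
  define m where "m = Polynomial.order 0 p"
  obtain q where q: "p = X ^ m * q" "\<not> X dvd q"
    using order_decomp[OF p(1), of 0] by (auto simp: X_def m_def)
  obtain c q' where q': "q = pCons c q'" by (cases q) auto
  have c: "c \<noteq> 0" using q(2) poly_eq_0_iff_dvd[of q 0] by (auto simp: q' X_def)
  define w where "w = Polynomial.smult (- inverse c) q'"
  have qw: "q = Polynomial.smult c (1 - X * w)"
    using c by (simp add: q' w_def X_def smult_diff_right one_pCons)
  have "P (X ^ m * (1 - X * w)) = 0"
    using p(2) c by (simp add: q(1) qw P_def poly_act_smult)
  then have base: "poly_act a (X ^ m) a = poly_act a (X ^ m * (X * w)) a"
    by (simp add: P_def right_diff_distrib poly_act_diff)
  have step: "P (s * X ^ m) = P (s * (X ^ m * (X * w)))" for s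
    unfolding P_def poly_act_mult[of a s] base ..
  have iter: "P (s * X ^ m) = P (s * (X * w) ^ k * X ^ m)" for s k
  proof (induction k)
    case (Suc k)
    then show ?case using step[of "s * (X * w) ^ k"] by (simp add: ac_simps)
  qed simp
  \<comment> \<open>Since \<open>P r\<close> is the value of X r, this is the value of (X
    w)^(m+1).\<close>
  define e where "e = P (X ^ m * w ^ Suc m)"
  have PP: "P r * P s = P (X * (r * s))" for r s
    unfolding P_def poly_act_self_mult X_def by (simp add: ac_simps del: mult_pCons_left mult_pCons_right)
  \<comment> \<open>The square carries \<open>Suc m\<close> surplus factors \<open>X * w\<close>
    next to \<open>X ^ m\<close>, which \<open>iter\<close> removes.\<close>
  have "e * e = P (w ^ Suc m * (X * w) ^ Suc m * X ^ m)"
    unfolding e_def PP by (simp add: power_mult_distrib ac_simps)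
  also have "\<dots> = e" unfolding e_def iter[symmetric] by (simp add: ac_simps)
  finally have ee: "e * e = e" .
  have "e = P (X * (X ^ m * w ^ Suc m * (X ^ m * w ^ Suc m)))"
    using ee unfolding e_def PP by simp
  then have et: "e = a * P (X ^ m * w ^ Suc m * (X ^ m * w ^ Suc m))"
    unfolding P_def poly_act_mult[of a X] by (simp add: X_def)
  have "e \<noteq> 0"
  proof
    assume "e = 0"
    \<comment> \<open>\<open>P (X ^ m)\<close> is the power a^(m+1). Inserting \<open>Suc m\<close>
      factors \<open>X * w\<close> writes it as X^(m+1) acting on \<open>e\<close>.\<close>
    have "P (X ^ m) = P ((X * w) ^ Suc m * X ^ m)" using iter[of 1 "Suc m"] by simp
    also have "\<dots> = P (X ^ Suc m * (X ^ m * w ^ Suc m))"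
      by (simp only: power_mult_distrib ac_simps)
    also have "\<dots> = 0" unfolding P_def poly_act_mult[of a "X ^ Suc m"]
      using \<open>e = 0\<close> by (simp add: e_def P_def)
    finally have "((*) a ^^ m) a = 0" by (simp add: P_def X_def poly_act_X_power)
    then show False using nn by (auto simp: nilp_def)
  qed
  then show ?thesis using et ee by metis
qed

section \<open>Nil algebras and Nakayama's lemma\<close>

lemma nilpotent_quasi_inverse:
  assumes R: "subalgebra R" "r \<in> R" and r: "nilp r"
  shows "\<exists>s\<in>R. s = r + r * s"
proof -
  obtain n where n: "((*) r ^^ n) r = 0" using r by (auto simp: nilp_def)
  have R': "((*) r ^^ i) r \<in> R" for i
    by (induction i) (auto intro: mult_in_subalgebra R)
  \<comment> \<open>The finite geometric series r + ... + r^n, which stands for (1 - r)^(-1) -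
    1.\<close>
  define s where "s = (\<Sum>i<n. ((*) r ^^ i) r)"
  have "s \<in> R" unfolding s_def by (intro subspace_sum subspace_subalgebra R R')
  moreover have "r + r * (\<Sum>i<k. ((*) r ^^ i) r) = (\<Sum>i<k. ((*) r ^^ i) r) + ((*) r ^^ k) r" for k
    by (induction k) (simp_all add: algebra_simps)
  then have "s = r + r * s" using n by (simp add: s_def)
  ultimately show ?thesis by blast
qed

lemma span_products_closed:
  assumes R: "subalgebra R" and z: "z \<in> span {w * r | w r. w \<in> W \<and> r \<in> R}" and s: "s \<in> R"
  shows "z * s \<in> span {w * r | w r. w \<in> W \<and> r \<in> R}"
  using z
proof (induction rule: span_induct_alt)
  case (step c x y)
  then obtain w r where "x = w * r" "w \<in> W" "r \<in> R" by auto
  then have "x * s \<in> span {w * r | w r. w \<in> W \<and> r \<in> R}"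
    using mult_in_subalgebra[OF R _ s, of r] by (intro span_base) (auto simp: mult.assoc)
  then show ?case using step by (simp add: distrib_right scale_mult_left span_add span_scale)
qed (simp add: span_zero)

text \<open>Induction on the number of generators: in k = k r + z, with z in the span of the
  products of the other generators with R, the nilpotent r is moved to the other side by its
  quasi-inverse, so the generator k is redundant.\<close>

lemma nil_nakayama:
  assumes R: "subalgebra R" "\<And>r. r \<in> R \<Longrightarrow> nilp r"
    and W: "finite W" "W \<subseteq> span {w * r | w r. w \<in> W \<and> r \<in> R}"
  shows "W \<subseteq> {0}"
  using W
proof (induction W)
  case (insert k W)
  define T where "T = span {w * r | w r. w \<in> W \<and> r \<in> R}"
  have split: "\<exists>r\<in>R. \<exists>z\<in>T. x = k * r + z"
    if "x \<in> span {w * r | w r. w \<in> insert k W \<and> r \<in> R}" for x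
    using that
  proof (induction rule: span_induct_alt)
    case base
    then show ?case using R(1) by (auto intro!: bexI[of _ 0] simp: T_def span_zero subspace_0 subspace_subalgebra)
  next
    case (step c x y)
    then obtain r z where rz: "r \<in> R" "z \<in> T" "y = k * r + z" by auto
    from step obtain w r' where w: "x = w * r'" "w \<in> insert k W" "r' \<in> R" by auto
    show ?case
    proof (cases "w = k")
      case True
      have "c *s x + y = k * (c *s r' + r) + z"
        using True w rz by (simp add: scale_mult_right algebra_simps)
      moreover have "c *s r' + r \<in> R"
        using w rz R(1) by (auto intro: subspace_add subspace_scale subspace_subalgebra)
      ultimately show ?thesis using rz by blast
    next
      case False
      then have "x \<in> T" using w unfolding T_def by (intro span_base) auto
      then have "c *s x + z \<in> T" using rz by (simp add: T_def span_add span_scale)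
      moreover have "c *s x + y = k * r + (c *s x + z)" using rz by simp
      ultimately show ?thesis using rz by blast
    qed
  qed
  have TR: "z * s \<in> T" if "z \<in> T" "s \<in> R" for z s
    using that span_products_closed[OF R(1)] unfolding T_def by blast
  obtain r z where rz: "r \<in> R" "z \<in> T" "k = k * r + z" using split insert.prems by blast
  obtain s where s: "s \<in> R" "s = r + r * s" using nilpotent_quasi_inverse R rz(1) by blast
  \<comment> \<open>Formally z = k (1 - r), and 1 + s is inverse to 1 - r, so z (1 + s) = k.\<close>
  have "z = k - k * r" using rz(3) by (metis add_diff_cancel_left')
  then have "z + z * s = k - k * r + k * s - k * (r * s)"
    by (simp only: left_diff_distrib mult.assoc) simp
  also have "\<dots> = k + k * (s - (r + r * s))" by (simp add: algebra_simps)
  also have "\<dots> = k" using s(2) by simp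
  finally have kz: "k = z + z * s" by simp
  have "z + z * s \<in> T" using rz(2) TR[OF rz(2) s(1)] unfolding T_def by (rule span_add)
  then have kT: "k \<in> T" using kz by simp
  have "W \<subseteq> T"
  proof
    fix w assume "w \<in> W"
    then obtain r z where "r \<in> R" "z \<in> T" "w = k * r + z" using split insert.prems by blast
    then show "w \<in> T" using TR[OF kT] by (auto simp: T_def intro: span_add)
  qed
  then have W0: "W \<subseteq> {0}" using insert.IH by (simp add: T_def)
  have "T \<subseteq> {0}" unfolding T_def using W0 by (intro span_minimal) auto
  then show ?case using kT W0 by auto
qed simp

end

section \<open>Simple locally finite algebras over algebraically closed fields\<close>

locale simple_lf_algebra = assoc_algebra scale
  for scale :: "'f::alg_closed_field \<Rightarrow> 'a::ring \<Rightarrow> 'a" (infixr \<open>*s\<close> 75) +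
  assumes simple: "simple_algebra (alg_on UNIV)"
    and lf: "locally_finite"
begin

lemma fin_dim_subalgebra_containing:
  assumes "finite X"
  obtains B where "subalgebra B" "fin_dim B" "X \<subseteq> B"
proof -
  have "\<exists>B. subalgebra B \<and> fin_dim B \<and> X \<subseteq> B"
    using lf assms by (simp add: locally_finite_def)
  then show ?thesis using that by auto
qed

lemma ideal_trivial:
  assumes "subspace I" "\<And>x b. x \<in> I \<Longrightarrow> x * b \<in> I" "\<And>x b. x \<in> I \<Longrightarrow> b * x \<in> I"
  shows "I = {0} \<or> I = UNIV"
proof -
  have "alg_ideal I (alg_on UNIV)"
    using assms by (auto simp: alg_ideal_def alg_on_def subspace_def)
  then show ?thesis using simple by (auto simp: simple_algebra_def alg_on_def)
qed

lemma span_sandwich: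
  assumes "y \<noteq> 0"
  shows "span {a * y * b | a b. True} = UNIV"
proof -
  let ?S = "{a * y * b | a b. True}"
  have "x * c \<in> span ?S \<and> c * x \<in> span ?S" if "x \<in> span ?S" for x c
    using that
  proof (induction rule: span_induct_alt)
    case (step k x z)
    then obtain a b where x: "x = a * y * b" by auto
    have "x * c = a * y * (b * c)" "c * x = (c * a) * y * b" by (simp_all add: x mult.assoc)
    then have "x * c \<in> span ?S" "c * x \<in> span ?S" by (auto intro!: span_base)
    then show ?case using step.IH
      by (simp add: distrib_left distrib_right scale_mult_left scale_mult_right span_add span_scale)
  qed (simp add: span_zero)
  then have "span ?S = {0} \<or> span ?S = UNIV" by (intro ideal_trivial) auto
  moreover have "span ?S \<noteq> {0}"
  proof
    assume "span ?S = {0}"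
    then have y0: "a * y * b = 0" for a b using span_base[of "a * y * b" ?S] by auto
    \<comment> \<open>Both sets are ideals: the z with A z A = 0, and the z with z A = 0. If A y A =
      0, the first is all of A, so the second contains a non-zero product p q and is all of A as
      well, which forces p q = 0.\<close>
    let ?N = "{z::'a. \<forall>a b. a * z * b = 0}" and ?L = "{z::'a. \<forall>b. z * b = 0}"
    have "?N = {0} \<or> ?N = UNIV"
    proof (rule ideal_trivial)
      fix x b assume "x \<in> ?N"
      then have "a * x * c = 0" for a c by simp
      then have "a * (x * b) * c = 0" "a * (b * x) * c = 0" for a c
        by (metis mult.assoc)+
      then show "x * b \<in> ?N" "b * x \<in> ?N" by auto
    qed (auto simp: subspace_def algebra_simps scale_mult_left scale_mult_right)
    then have N: "?N = UNIV" using y0 assms by blast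
    have "?L = {0} \<or> ?L = UNIV"
    proof (rule ideal_trivial)
      fix x b assume "x \<in> ?L"
      then show "x * b \<in> ?L" "b * x \<in> ?L" by (auto simp: mult.assoc)
    qed (auto simp: subspace_def algebra_simps scale_mult_left)
    moreover obtain p q where pq: "p * q \<noteq> (0::'a)"
      using simple by (auto simp: simple_algebra_def alg_on_def)
    moreover have "p * q \<in> ?L" using N by auto
    ultimately have "?L = UNIV" by auto
    then show False using pq by auto
  qed
  ultimately show ?thesis by blast
qed

text \<open>The left factor a of a x b is itself a combination of elements a' x b', because A x A =
  A.\<close>

lemma span_sandwich2:
  assumes "x \<noteq> 0"
  shows "span {a * x * b * x * c | a b c. True} = UNIV"
proof -
  let ?S = "{a * x * b * x * c | a b c. True}"
  have "a * x * b \<in> span ?S" for a b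
  proof -
    have "a \<in> span {a * x * b | a b. True}" using span_sandwich[OF assms] by simp
    then show ?thesis
    proof (induction rule: span_induct_alt)
      case (step k z y)
      then have "z * x * b \<in> span ?S" by (intro span_base) auto
      then show ?case using step
        by (simp add: distrib_right scale_mult_left span_add span_scale)
    qed (simp add: span_zero)
  qed
  then have "{a * x * b | a b. True} \<subseteq> span ?S" by auto
  then have "span {a * x * b | a b. True} \<subseteq> span ?S" by (simp add: span_minimal)
  then show ?thesis using span_sandwich[OF assms] by auto
qed

text \<open>
  Writing \<open>x\<close> as a combination of elements \<open>a x b x c = (a x b) (x c)\<close> with \<open>a\<close>, \<open>b\<close>, \<open>c\<close> in a
  finite dimensional subalgebra \<open>B\<close> shows that \<open>M = B x B\<close> satisfies \<open>M = M R\<close> for the right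
  ideal \<open>R\<close> generated by \<open>x\<close>; if \<open>R\<close> is nil, Nakayama's lemma gives \<open>M = 0\<close>.
\<close>

lemma not_nil_right_ideal:
  assumes "x \<noteq> 0"
  shows "\<exists>y. \<not> nilp (x * y)"
proof (rule ccontr)
  assume "\<not> ?thesis"
  then have nil: "nilp (x * y)" for y by auto
  have "x \<in> span {a * x * b * x * c | a b c. True}" using span_sandwich2[OF assms] by simp
  then obtain t where t: "finite t" "t \<subseteq> {a * x * b * x * c | a b c. True}" "x \<in> span t"
    by (auto simp: span_explicit)
  let ?f = "\<lambda>(a, b, c). a * x * b * x * c"
  have "{a * x * b * x * c | a b c. True} = range ?f" by (simp add: image_def)
  then have "t \<subseteq> range ?f" using t(2) by simp
  from finite_subset_image[OF t(1) this] obtain C where C: "finite C" "t = ?f ` C" by auto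
  \<comment> \<open>Only finitely many coefficients occur in the expansion of \<open>x\<close>;
    \<open>B\<close> is chosen to contain them together with \<open>x\<close>.\<close>
  define G where "G = insert x (\<Union>(a, b, c)\<in>C. {a, b, c})"
  have "finite G" using C by (auto simp: G_def)
  then obtain B where B: "subalgebra B" "fin_dim B" "G \<subseteq> B"
    using lf by (auto simp: locally_finite_def)
  have xB: "x \<in> B" using B(3) by (auto simp: G_def)
  have CB: "a \<in> B \<and> b \<in> B \<and> c \<in> B" if "(a, b, c) \<in> C" for a b c
    using that B(3) unfolding G_def by blast
  obtain X where X: "finite X" "span X = B" using B(2) by (auto simp: fin_dim_def)
  define W where "W = {y * x * z | y z. y \<in> X \<and> z \<in> X}"
  define R where "R = range (\<lambda>y. x * y)"
  have R: "subalgebra R"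
    unfolding subalgebra_def subspace_def R_def
    by (auto simp: image_iff mult.assoc) (metis mult_zero_right, metis distrib_left, metis scale_mult_right)
  have BW: "b * x * c \<in> span W" if "b \<in> B" "c \<in> B" for b c
  proof -
    have 1: "b * x * z \<in> span W" if "z \<in> X" for z
    proof -
      have "b \<in> span X" using \<open>b \<in> B\<close> X by simp
      then show ?thesis
      proof (induction rule: span_induct_alt)
        case (step k y b')
        then have "y * x * z \<in> span W" using that by (intro span_base) (auto simp: W_def)
        then show ?case using step by (simp add: distrib_right scale_mult_left span_add span_scale)
      qed (simp add: span_zero)
    qed
    have "c \<in> span X" using \<open>c \<in> B\<close> X by simp
    then show ?thesis
    proof (induction rule: span_induct_alt)
      case (step k y b')
      then show ?case using 1 by (simp add: distrib_left scale_mult_right span_add span_scale)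
    qed (simp add: span_zero)
  qed
  let ?T = "span {w * r | w r. w \<in> W \<and> r \<in> R}"
  have WT: "m * r \<in> ?T" if "m \<in> span W" "r \<in> R" for m r
    using that(1)
  proof (induction rule: span_induct_alt)
    case (step k y b')
    then have "y * r \<in> ?T" using that(2) by (intro span_base) auto
    then show ?case using step by (simp add: distrib_right scale_mult_left span_add span_scale)
  qed (simp add: span_zero)
  have "y * x * z \<in> ?T" if yz: "y \<in> B" "z \<in> B" for y z
    using t(3)
  proof (induction rule: span_induct_alt)
    case (step k v u)
    then obtain a b c where abc: "(a, b, c) \<in> C" "v = a * x * b * x * c" by (auto simp: C)
    have "(y * a) * x * b \<in> span W" using CB[OF abc(1)] yz B(1) by (intro BW mult_in_subalgebra) auto
    then have "((y * a) * x * b) * (x * (c * z)) \<in> ?T" by (intro WT) (auto simp: R_def)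
    then have "y * v * z \<in> ?T" by (simp add: abc mult.assoc)
    then show ?case using step
      by (simp add: distrib_right distrib_left scale_mult_left scale_mult_right span_add span_scale)
  qed (simp add: span_zero)
  moreover have "X \<subseteq> B" using X span_superset by auto
  ultimately have "W \<subseteq> ?T" unfolding W_def by blast
  moreover have "W = (\<lambda>(y, z). y * x * z) ` (X \<times> X)" by (force simp: W_def)
  then have "finite W" using X by simp
  ultimately have "W \<subseteq> {0}" using nil by (intro nil_nakayama[OF R]) (auto simp: R_def)
  then have "span W \<subseteq> {0}" by (intro span_minimal) auto
  then have BxB: "b * x * c = 0" if "b \<in> B" "c \<in> B" for b c using BW[OF that] by auto
  \<comment> \<open>Every term a x b x c of the expansion of \<open>x\<close> has the left factor a
    x b in B x B = 0, so \<open>x\<close> would vanish.\<close>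
  have "t \<subseteq> {0}"
    using CB BxB by (auto simp: C)
  then have "span t \<subseteq> {0}" by (intro span_minimal) auto
  then show False using t(3) assms by auto
qed

text \<open>From x y = 0 the elements y x and then all x a y have square zero, hence vanish. So A x
  A annihilates y from the left; if x is non-zero this is all of A, and y y = 0.\<close>

lemma reduced_imp_domain:
  assumes red: "\<And>x::'a. x * x = 0 \<Longrightarrow> x = 0" and xy: "x * y = (0::'a)"
  shows "x = 0 \<or> y = 0"
proof -
  have "(y * x) * (y * x) = y * (x * y) * x" by (simp add: mult.assoc)
  then have yx: "y * x = 0" using red[of "y * x"] xy by simp
  have "x * a * y = 0" for a
  proof (rule red)
    have "x * a * y * (x * a * y) = x * a * (y * x) * a * y" by (simp add: mult.assoc)
    then show "x * a * y * (x * a * y) = 0" using yx by simp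
  qed
  then have 0: "a * x * b * y = 0" for a b by (metis mult.assoc mult_zero_right)
  show ?thesis
  proof (cases "x = 0")
    case False
    have "z * y = 0" if "z \<in> span {a * x * b | a b. True}" for z
      using that
    proof (induction rule: span_induct_alt)
      case (step c z w)
      then show ?case using 0 by (auto simp: distrib_right scale_mult_left)
    qed simp
    then show ?thesis using red[of y] span_sandwich[OF False] by simp
  qed simp
qed

text \<open>In a domain an idempotent e is a left identity, since e (e x - x) = 0. A polynomial
  annihilating b splits into linear factors, one of which must vanish, so b is a scalar multiple of
  e.\<close>

lemma domain_one_dimensional:
  assumes dom: "\<And>x y::'a. x * y = 0 \<Longrightarrow> x = 0 \<or> y = 0"
  shows "\<exists>e. span {e} = UNIV"
proof -
  obtain a :: 'a where a: "a \<noteq> 0"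
    using simple by (auto simp: simple_algebra_def alg_on_def)
  obtain y where y: "\<not> nilp (a * y)" using not_nil_right_ideal[OF a] by blast
  obtain B where B: "subalgebra B" "fin_dim B" "{a * y} \<subseteq> B"
    using lf unfolding locally_finite_def by blast
  have "a * y \<in> B" using B(3) by simp
  from idempotent_multiple[OF B(1,2) this y]
  obtain t where "a * y * t \<noteq> 0" "a * y * t * (a * y * t) = a * y * t" by blast
  then obtain e :: 'a where e: "e * e = e" "e \<noteq> 0" by metis
  have "e * (e * x - x) = 0" for x 
    by (simp add: right_diff_distrib mult.assoc[symmetric] e(1))
  then have ex: "e * x = x" for x using dom e(2) by (metis eq_iff_diff_eq_0)
  have "b \<in> span {e}" for b
  proof -
    have *: "b \<in> span {e}" if "p \<noteq> 0" "poly_act b p e = 0" for p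
      using that
    proof (induction "degree p" arbitrary: p rule: less_induct)
      case less
      show ?case
      proof (cases "degree p = 0")
        case True
        then obtain c where "p = [:c:]" by (metis degree_eq_zeroE)
        then show ?thesis using less.prems e(2) by simp
      next
        case False
        then obtain z where "poly p z = 0" using alg_closed_imp_poly_has_root by blast
        then obtain q where q: "p = [:- z, 1:] * q" by (metis poly_eq_0_iff_dvd dvdE)
        define v where "v = poly_act b q e"
        have "q \<noteq> 0" using less.prems q by auto
        have "degree q < degree p" using \<open>q \<noteq> 0\<close> unfolding q by (subst degree_mult_eq) auto
        have "(b - z *s e) * v = poly_act b p e"
          unfolding q poly_act_mult v_def by (simp add: algebra_simps scale_mult_left ex)
        then have "b - z *s e = 0 \<or> v = 0" using less.prems dom[of "b - z *s e" v] by simp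
        then show ?thesis
        proof
          assume "b - z *s e = 0"
          then have "b = z *s e" by simp
          then show ?thesis by (simp add: span_scale span_base)
        next
          assume "v = 0"
          then show ?thesis using less.hyps[OF \<open>degree q < degree p\<close> \<open>q \<noteq> 0\<close>] by (simp add: v_def)
        qed
      qed
    qed
    obtain B where B: "subalgebra B" "fin_dim B" "{b} \<subseteq> B"
      using lf unfolding locally_finite_def by blast
    obtain p where p: "p \<noteq> 0" "poly_act b p b = 0"
      using annihilating_poly[OF B(1,2)] B(3) by auto
    \<comment> \<open>Because e b = b, a polynomial that kills \<open>b\<close> kills e times
      \<open>b\<close>; cancelling \<open>b\<close> shows that it kills \<open>e\<close>.\<close>
    have "poly_act b p e * b = 0" using p(2) poly_act_mult_right[of b p e b] by (simp add: ex)
    then have "b = 0 \<or> poly_act b p e = 0" using dom by blast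
    then show ?thesis using * p(1) span_zero by blast
  qed
  then show ?thesis by blast
qed

text \<open>The relations say that \<open>u\<close> and \<open>v\<close> are the off-diagonal 2 by 2
  matrix units, with \<open>u * v\<close> and \<open>v * u\<close> as the diagonal ones.\<close>

lemma ex_matrix_units:
  assumes inf: "countably_infinite_dimensional"
  shows "\<exists>u v. u * v * u = u \<and> v * u * v = v \<and> u * u = 0 \<and> v * v = 0 \<and> u \<noteq> (0::'a)"
proof -
  have "\<exists>x::'a. x * x = 0 \<and> x \<noteq> 0"
  proof (rule ccontr)
    assume "\<not> ?thesis"
    then obtain e where e: "span {e} = UNIV"
      using domain_one_dimensional[OF reduced_imp_domain] by blast
    obtain X where "independent X" "infinite X"
      using inf by (auto simp: countably_infinite_dimensional_def)
    then show False using independent_span_bound[of "{e}" X] e by auto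
  qed
  then obtain x :: 'a where x: "x * x = 0" "x \<noteq> 0" by blast
  obtain y where y: "\<not> nilp (x * y)" using not_nil_right_ideal[OF x(2)] by blast
  obtain B where B: "subalgebra B" "fin_dim B" "{x * y} \<subseteq> B"
    using lf unfolding locally_finite_def by blast
  obtain t where t: "x * y * t \<noteq> 0" "x * y * t * (x * y * t) = x * y * t"
    using idempotent_multiple[OF B(1,2) _ y] B(3) by auto
  \<comment> \<open>The idempotent \<open>x * s\<close> is going to be \<open>u * v\<close>: the
    second term of \<open>v\<close> contributes nothing to that product because x x = 0.\<close>
  define s where "s = y * t"
  have g: "x * s \<noteq> 0" and gg: "x * s * (x * s) = x * s"
    using t by (simp_all add: s_def mult.assoc)
  have gg': "x * (s * (x * s)) = x * s" "x * (s * (x * (s * z))) = x * (s * z)" for z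
    using gg by (metis mult.assoc)+
  have xx': "x * (x * z) = 0" for z using x(1) by (metis mult.assoc mult_zero_left)
  \<comment> \<open>The second term of \<open>v\<close> only serves to make \<open>v\<close> square to zero.\<close>
  define u where "u = x * s * x"
  define v where "v = s * x * s - x * s * s * x * s"
  have "u * v * u = u" "v * u * v = v" "u * u = 0" "v * v = 0"
    by (simp_all add: u_def v_def algebra_simps gg' xx' x(1))
  moreover have "u \<noteq> 0" using g gg' by (metis u_def mult.assoc mult_zero_left)
  ultimately show ?thesis by blast
qed

end

section \<open>Composition series\<close>

text \<open>These are the pivot positions of an echelon basis; counting them measures dimension
  without choosing a basis.\<close>

definition leading_positions :: "nat \<Rightarrow> 'f::field vec set \<Rightarrow> nat set" where
  "leading_positions n U = {i. i < n \<and> (\<exists>u\<in>U. u $ i \<noteq> 0 \<and> (\<forall>j<i. u $ j = 0))}"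

text \<open>The number of leading positions of a subspace is its dimension.\<close>

lemma leading_positions_strict:
  assumes U: "rep_submodule C n \<rho> U" and W: "rep_submodule C n \<rho> W" and "U \<subset> W"
  shows "leading_positions n U \<subset> leading_positions n W"
proof -
  have "leading_positions n U \<subseteq> leading_positions n W"
    using \<open>U \<subset> W\<close> by (auto simp: leading_positions_def)
  moreover have False if sub: "leading_positions n W \<subseteq> leading_positions n U"
  proof -
    \<comment> \<open>Downward induction on \<open>k\<close>, by Gaussian elimination: at k = n only
      the zero vector is left, at k = 0 all of \<open>W\<close> is covered, and each step clears
      entry \<open>k\<close> with a vector of \<open>U\<close> having that leading position.\<close>
    have "\<forall>w\<in>W. (\<forall>j<k. w $ j = 0) \<longrightarrow> w \<in> U" if "k \<le> n" for k
      using that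
    proof (induction k rule: inc_induct)
      case base
      have "w = 0\<^sub>v n" if "w \<in> W" "\<forall>j<n. w $ j = 0" for w
        using that W by (intro eq_vecI) (auto simp: rep_submodule_def)
      then show ?case using U by (auto simp: rep_submodule_def)
    next
      case (step k)
      show ?case
      proof (intro ballI impI)
        fix w assume w: "w \<in> W" "\<forall>j<k. w $ j = 0"
        show "w \<in> U"
        proof (cases "w $ k = 0")
          case True
          then show ?thesis using step.IH w by (auto simp: less_Suc_eq)
        next
          case False
          then have "k \<in> leading_positions n U"
            using sub w step.hyps by (auto simp: leading_positions_def)
          then obtain u where u: "u \<in> U" "u $ k \<noteq> 0" "\<forall>j<k. u $ j = 0"
            by (auto simp: leading_positions_def)
          define c where "c = w $ k / u $ k"
          define z where "z = w + (- c) \<cdot>\<^sub>v u"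
          have dims: "w \<in> carrier_vec n" "u \<in> carrier_vec n"
            using w(1) u(1) U W by (auto simp: rep_submodule_def)
          have "z \<in> W" using w(1) u(1) W \<open>U \<subset> W\<close> by (auto simp: rep_submodule_def z_def)
          moreover have "\<forall>j<Suc k. z $ j = 0"
            using dims step.hyps u w by (auto simp: z_def c_def less_Suc_eq)
          ultimately have "z \<in> U" using step.IH by blast
          moreover have "w = z + c \<cdot>\<^sub>v u"
            using dims by (intro eq_vecI) (auto simp: z_def)
          ultimately show ?thesis using U u(1) by (auto simp: rep_submodule_def)
        qed
      qed
    qed
    from this[of 0] show False using \<open>U \<subset> W\<close> by auto
  qed
  ultimately show ?thesis by blast
qed

text \<open>A strict chain of submodules has at most \<open>n\<close> steps, since the leading
  positions grow strictly. A chain of greatest length exists, and it cannot be refined.\<close>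

lemma composition_series_exists:
  assumes \<rho>: "\<And>a. a \<in> C \<Longrightarrow> \<rho> a \<in> carrier_mat n n"
  shows "\<exists>m V. composition_series C n \<rho> m V"
proof -
  define chain where "chain m V \<longleftrightarrow> V 0 = {0\<^sub>v n} \<and> V m = carrier_vec n
     \<and> (\<forall>j\<le>m. rep_submodule C n \<rho> (V j)) \<and> (\<forall>j<m. V j \<subset> V (Suc j))" for m V
  have "\<rho> a *\<^sub>v 0\<^sub>v n = 0\<^sub>v n" if "a \<in> C" for a
    using \<rho>[OF that] by (intro eq_vecI) auto
  then have sub0: "rep_submodule C n \<rho> {0\<^sub>v n}"
    by (auto simp: rep_submodule_def)
  have sub1: "rep_submodule C n \<rho> (carrier_vec n)"
    using \<rho> by (auto simp: rep_submodule_def intro: mult_mat_vec_carrier)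
  have ex: "\<exists>m V. chain m V"
  \<comment> \<open>When the module is zero, its two ends coincide and the strict chain has length
    0.\<close>
  proof (cases "{0\<^sub>v n} = (carrier_vec n :: 'b vec set)")
    case True
    then have "chain 0 (\<lambda>_. carrier_vec n)" using sub1 by (auto simp: chain_def)
    then show ?thesis by blast
  next
    case False
    then have "chain 1 (\<lambda>i. if i = 0 then {0\<^sub>v n} else carrier_vec n)"
      using sub0 sub1 by (auto simp: chain_def)
    then show ?thesis by blast
  qed
  have bound: "m \<le> n" if ch: "chain m V" for m V
  proof -
    have "j \<le> card (leading_positions n (V j))" if "j \<le> m" for j
      using that
    proof (induction j)
      case (Suc j)
      have "leading_positions n (V j) \<subset> leading_positions n (V (Suc j))"
        using ch Suc.prems by (intro leading_positions_strict[of C n \<rho>]) (auto simp: chain_def)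
      moreover have "finite (leading_positions n (V (Suc j)))"
        by (simp add: leading_positions_def)
      ultimately have "card (leading_positions n (V j)) < card (leading_positions n (V (Suc j)))"
        by (rule psubset_card_mono[rotated])
      then show ?case using Suc by simp
    qed simp
    from this[of m] have "m \<le> card (leading_positions n (V m))" by simp
    also have "\<dots> \<le> card {..<n}"
      by (intro card_mono) (auto simp: leading_positions_def)
    finally show ?thesis by simp
  qed
  define m where "m = (GREATEST m. \<exists>V. chain m V)"
  have "\<exists>V. chain m V"
    unfolding m_def by (rule GreatestI_ex_nat[OF ex, of n]) (auto dest: bound)
  moreover have max: "k \<le> m" if "chain k V" for k V
    unfolding m_def by (rule Greatest_le_nat[of _ _ n]) (use that in \<open>auto dest: bound\<close>)
  ultimately obtain V where V: "chain m V" by blast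
  have maximal: "U = V j \<or> U = V (Suc j)"
    if j: "j < m" and U: "rep_submodule C n \<rho> U" "V j \<subseteq> U" "U \<subseteq> V (Suc j)" for j U
  proof (rule ccontr)
    assume neq: "\<not> ?thesis"
    \<comment> \<open>The chain with \<open>U\<close> inserted between \<open>V j\<close> and
      \<open>V (Suc j)\<close>; later members shift by one.\<close>
    define V' where "V' i = (if i \<le> j then V i else if i = Suc j then U else V (i - 1))" for i
    have "chain (Suc m) V'"
      unfolding chain_def
    proof (intro conjI allI impI)
      show "V' 0 = {0\<^sub>v n}" "V' (Suc m) = carrier_vec n"
        using V j by (auto simp: V'_def chain_def)
    next
      fix i assume "i \<le> Suc m"
      then show "rep_submodule C n \<rho> (V' i)" using V j U(1) by (auto simp: V'_def chain_def)
    next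
      fix i assume i: "i < Suc m"
      consider "i < j" | "i = j" | "i = Suc j" | "Suc j < i" by linarith
      then show "V' i \<subset> V' (Suc i)"
      proof cases
        case 4
        moreover have "i - 1 < m" using i 4 by simp
          ultimately have "V (i - 1) \<subset> V (Suc (i - 1))" using V unfolding chain_def by blast
        then show ?thesis using 4 by (auto simp: V'_def)
      qed (use V j U neq in \<open>auto simp: V'_def chain_def\<close>)
    qed
    then show False using max[of "Suc m" V'] by simp
  qed
  have "composition_series C n \<rho> m V"
    unfolding composition_series_def
  proof (intro conjI allI impI)
    show "V 0 = {0\<^sub>v n}" "V m = carrier_vec n" using V by (simp_all add: chain_def)
    show "rep_submodule C n \<rho> (V j)" if "j \<le> m" for j using V that by (simp add: chain_def)
    show "V j \<subset> V (Suc j)" if "j < m" for j using V that by (simp add: chain_def)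
  qed (use maximal in simp)
  then show ?thesis by blast
qed

text \<open>A non-zero column \<open>w\<close> of the idempotent matrix \<open>\<rho> e\<close> is
  fixed by it. If \<open>V k\<close> is the first member of a composition series containing
  \<open>w\<close>, then \<open>e\<close> does not act as zero on the factor just below
  \<open>V k\<close>.\<close>

lemma nontrivial_composition_factorI:
  assumes \<rho>: "\<And>a. a \<in> C \<Longrightarrow> \<rho> a \<in> carrier_mat n n"
    and e: "e \<in> C" "\<rho> e * \<rho> e = \<rho> e" "\<rho> e \<noteq> 0\<^sub>m n n"
  shows "has_nontrivial_composition_factor C n \<rho>"
proof -
  have c: "\<rho> e \<in> carrier_mat n n" using \<rho> e by blast
  obtain i j where ij: "i < n" "j < n" "\<rho> e $$ (i, j) \<noteq> 0"
    using e(3) c by (metis carrier_matD eq_matI index_zero_mat)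
  define w where "w = \<rho> e *\<^sub>v unit_vec n j"
  have wc: "w \<in> carrier_vec n" using c by (auto simp: w_def)
  have "w $ i = \<rho> e $$ (i, j)"
    using ij c by (simp add: w_def)
  then have w0: "w \<noteq> 0\<^sub>v n" using ij by auto
  have we: "\<rho> e *\<^sub>v w = w"
    unfolding w_def using c e(2) by (simp add: assoc_mult_mat_vec[symmetric, of _ n n _ n])
  obtain m V where V: "composition_series C n \<rho> m V" using composition_series_exists \<rho> by blast
  have wm: "w \<in> V m" using V wc by (simp add: composition_series_def)
  define k where "k = (LEAST k. w \<in> V k)"
  have k: "w \<in> V k" "k \<le> m" unfolding k_def using wm by (auto intro: LeastI Least_le)
  have "k \<noteq> 0" using k w0 V by (auto simp: composition_series_def)
  then obtain l where l: "k = Suc l" by (cases k) auto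
  have "w \<notin> V l" using not_less_Least[of l "\<lambda>k. w \<in> V k"] l by (simp add: k_def)
  then show ?thesis
    unfolding has_nontrivial_composition_factor_def
    using V k l e(1) we
    by (intro exI[of _ m] exI[of _ V] conjI exI[of _ l] bexI[of _ e] bexI[of _ w]) simp_all
qed

section \<open>Natural representations\<close>

text \<open>The locale \<^locale>\<open>ring\<close> of HOL-Algebra requires an identity element.\<close>

locale nonunital_ring = abelian_monoid Q for Q :: "('f, 'v) module" (structure) +
  assumes m_closed: "\<lbrakk>x \<in> carrier Q; y \<in> carrier Q\<rbrakk> \<Longrightarrow> x \<otimes> y \<in> carrier Q"
    and l_distr: "\<lbrakk>x \<in> carrier Q; y \<in> carrier Q; z \<in> carrier Q\<rbrakk> \<Longrightarrow> (x \<oplus> y) \<otimes> z = x \<otimes> z \<oplus> y \<otimes> z"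
    and r_distr: "\<lbrakk>x \<in> carrier Q; y \<in> carrier Q; z \<in> carrier Q\<rbrakk> \<Longrightarrow> z \<otimes> (x \<oplus> y) = z \<otimes> x \<oplus> z \<otimes> y"
    and l_null: "x \<in> carrier Q \<Longrightarrow> \<zero> \<otimes> x = \<zero>"
    and r_null: "x \<in> carrier Q \<Longrightarrow> x \<otimes> \<zero> = \<zero>"
begin

lemma finsum_mult_right:
  assumes "finite A" "f \<in> A \<rightarrow> carrier Q" "y \<in> carrier Q"
  shows "(\<Oplus>j\<in>A. f j) \<otimes> y = (\<Oplus>j\<in>A. f j \<otimes> y)"
  using assms
  by (induction A) (auto simp: l_null l_distr m_closed Pi_iff)

lemma finsum_mult_left:
  assumes "finite A" "f \<in> A \<rightarrow> carrier Q" "y \<in> carrier Q"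
  shows "y \<otimes> (\<Oplus>j\<in>A. f j) = (\<Oplus>j\<in>A. y \<otimes> f j)"
  using assms
  by (induction A) (auto simp: r_null r_distr m_closed Pi_iff)

context
  fixes k :: nat and S :: "nat \<Rightarrow> 'v set"
  assumes dsum: "direct_sum_of_ideals Q k S"
begin

lemma summand_ideal: "j < k \<Longrightarrow> alg_ideal (S j) Q"
  using dsum by (simp add: direct_sum_of_ideals_def)

lemma summand_carrier: "j < k \<Longrightarrow> x \<in> S j \<Longrightarrow> x \<in> carrier Q"
  using summand_ideal unfolding alg_ideal_def by blast

lemma summand_mult:
  "j < k \<Longrightarrow> x \<in> S j \<Longrightarrow> y \<in> carrier Q \<Longrightarrow> x \<otimes> y \<in> S j"
  "j < k \<Longrightarrow> x \<in> S j \<Longrightarrow> y \<in> carrier Q \<Longrightarrow> y \<otimes> x \<in> S j"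
  using summand_ideal by (auto simp: alg_ideal_def)

lemma summand_zero: "j < k \<Longrightarrow> \<zero> \<in> S j"
  using summand_ideal by (auto simp: alg_ideal_def)

lemma summand_proj_in: "x \<in> carrier Q \<Longrightarrow> j < k \<Longrightarrow> summand_proj Q k S j x \<in> S j"
  and finsum_summand_proj: "x \<in> carrier Q \<Longrightarrow> x = (\<Oplus>j\<in>{..<k}. summand_proj Q k S j x)"
proof -
  assume x: "x \<in> carrier Q"
  then have "\<exists>!s. s \<in> (\<Pi>\<^sub>E j\<in>{..<k}. S j) \<and> x = (\<Oplus>j\<in>{..<k}. s j)"
    using dsum by (simp add: direct_sum_of_ideals_def)
  from theI'[OF this]
  have 1: "(\<lambda>j. summand_proj Q k S j x) \<in> (\<Pi>\<^sub>E j\<in>{..<k}. S j)"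
    and 2: "x = (\<Oplus>j\<in>{..<k}. summand_proj Q k S j x)"
    by (simp_all add: summand_proj_def)
  show "x = (\<Oplus>j\<in>{..<k}. summand_proj Q k S j x)" by (fact 2)
  show "summand_proj Q k S j x \<in> S j" if "j < k" using 1 that by auto
qed

lemma summand_proj_eqI:
  assumes s: "\<And>j. j < k \<Longrightarrow> s j \<in> S j" and x: "x = (\<Oplus>j\<in>{..<k}. s j)" and i: "i < k"
  shows "summand_proj Q k S i x = s i"
proof -
  have sc: "s \<in> {..<k} \<rightarrow> carrier Q" using s summand_carrier by auto
  have xc: "x \<in> carrier Q" unfolding x using sc by (rule finsum_closed)
  have ex1: "\<exists>!s. s \<in> (\<Pi>\<^sub>E j\<in>{..<k}. S j) \<and> x = (\<Oplus>j\<in>{..<k}. s j)"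
    using dsum xc by (simp add: direct_sum_of_ideals_def)
  \<comment> \<open>Uniqueness of the decomposition is stated for extensional families, hence the
    restriction.\<close>
  have "restrict s {..<k} \<in> (\<Pi>\<^sub>E j\<in>{..<k}. S j)" using s by auto
  moreover have "x = (\<Oplus>j\<in>{..<k}. restrict s {..<k} j)"
    unfolding x using sc by (intro finsum_cong') auto
  ultimately have "(THE s. s \<in> (\<Pi>\<^sub>E j\<in>{..<k}. S j) \<and> x = (\<Oplus>j\<in>{..<k}. s j)) = restrict s {..<k}"
    by (intro the1_equality[OF ex1]) auto
  then show ?thesis using i by (simp add: summand_proj_def)
qed

lemma summand_proj_single:
  assumes x: "x \<in> S l" and l: "l < k" and i: "i < k"
  shows "summand_proj Q k S i x = (if l = i then x else \<zero>)"
proof -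
  have "(\<Oplus>j\<in>{..<k}. if l = j then x else \<zero>) = x"
    using finsum_singleton[of l "{..<k}" "\<lambda>_. x"] l summand_carrier[OF l x] by auto
  then show ?thesis
    using x summand_zero by (intro summand_proj_eqI[OF _ _ i]) auto
qed

text \<open>The product lies in both ideals. Its component at \<open>j\<close> is the product itself
  when it is viewed in \<open>S j\<close>, and zero when it is viewed in \<open>S l\<close>.\<close>

lemma summand_mult_eq_zero:
  assumes "j < k" "l < k" "j \<noteq> l" "x \<in> S j" "y \<in> S l"
  shows "x \<otimes> y = \<zero>"
proof -
  have "x \<otimes> y \<in> S j" "x \<otimes> y \<in> S l"
    using assms summand_mult summand_carrier by blast+
  then show ?thesis
    using summand_proj_single[of "x \<otimes> y" j j] summand_proj_single[of "x \<otimes> y" l j] assms by simp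
qed

lemma summand_proj_add:
  assumes x: "x \<in> carrier Q" and y: "y \<in> carrier Q" and i: "i < k"
  shows "summand_proj Q k S i (x \<oplus> y) = summand_proj Q k S i x \<oplus> summand_proj Q k S i y"
proof (rule summand_proj_eqI[OF _ _ i])
  fix j assume j: "j < k"
  then show "summand_proj Q k S j x \<oplus> summand_proj Q k S j y \<in> S j"
    using summand_ideal summand_proj_in x y by (auto simp: alg_ideal_def)
next
  show "x \<oplus> y = (\<Oplus>j\<in>{..<k}. summand_proj Q k S j x \<oplus> summand_proj Q k S j y)"
    by (subst finsum_addf)
      (use x y finsum_summand_proj[of x, symmetric] finsum_summand_proj[of y, symmetric]
        in \<open>auto intro: summand_carrier summand_proj_in\<close>)
qed

text \<open>Products of components with different indices vanish, so multiplying the component of x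
  at j by y only sees the component of y at j.\<close>

lemma summand_proj_mult:
  assumes x: "x \<in> carrier Q" and y: "y \<in> carrier Q" and i: "i < k"
  shows "summand_proj Q k S i (x \<otimes> y) = summand_proj Q k S i x \<otimes> summand_proj Q k S i y"
proof (rule summand_proj_eqI[OF _ _ i])
  fix j assume j: "j < k"
  then show "summand_proj Q k S j x \<otimes> summand_proj Q k S j y \<in> S j"
    using summand_mult(1) summand_proj_in summand_carrier x y by blast
next
  let ?p = "\<lambda>j. summand_proj Q k S j x" and ?q = "\<lambda>j. summand_proj Q k S j y"
  have pc: "?p j \<in> carrier Q" "?q j \<in> carrier Q" if "j < k" for j
    using that x y summand_proj_in summand_carrier by blast+
  have "?p j \<otimes> y = ?p j \<otimes> ?q j" if j: "j < k" for j
  proof -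
    have "?p j \<otimes> y = ?p j \<otimes> (\<Oplus>l\<in>{..<k}. ?q l)" using finsum_summand_proj[OF y] by simp
    also have "\<dots> = (\<Oplus>l\<in>{..<k}. ?p j \<otimes> ?q l)"
      using pc j by (intro finsum_mult_left) auto
    also have "\<dots> = (\<Oplus>l\<in>{..<k}. if j = l then ?p j \<otimes> ?q l else \<zero>)"
      using pc j x y
      by (intro finsum_cong') (auto simp: m_closed summand_mult_eq_zero summand_proj_in)
    also have "\<dots> = ?p j \<otimes> ?q j"
      using pc j by (intro finsum_singleton) (auto intro: m_closed)
    finally show ?thesis .
  qed
  moreover have "x \<otimes> y = (\<Oplus>j\<in>{..<k}. ?p j \<otimes> y)"
    using pc y finsum_mult_right[of "{..<k}" ?p y] finsum_summand_proj[OF x] by auto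
  ultimately show "x \<otimes> y = (\<Oplus>j\<in>{..<k}. ?p j \<otimes> ?q j)"
    using pc y by (simp cong: finsum_cong') (intro finsum_cong'; auto intro: m_closed)
qed

end

end

section \<open>The radical, quotient algebras and the homomorphism property of natural
  representations\<close>

context assoc_algebra
begin

lemma alg_ideal_alg_on:
  "alg_ideal I (alg_on C) \<longleftrightarrow> I \<subseteq> C \<and> subspace I \<and> (\<forall>x\<in>I. \<forall>b\<in>C. x * b \<in> I \<and> b * x \<in> I)"
  by (auto simp: alg_ideal_def alg_on_def subspace_def)

lemma rad_ideal:
  assumes C: "subalgebra C"
  shows "alg_ideal (rad C) (alg_on C)"
proof -
  let ?U = "\<Union>{I. alg_ideal I (alg_on C) \<and> nilpotent I}"
  have "?U \<subseteq> C" by (auto simp: alg_ideal_alg_on)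
  then have "rad C \<subseteq> C" unfolding rad_def using C by (intro span_minimal subspace_subalgebra)
  moreover have "x * b \<in> rad C \<and> b * x \<in> rad C" if "x \<in> rad C" "b \<in> C" for x b
    using that(1) unfolding rad_def
  proof (induction rule: span_induct_alt)
    case (step c x y)
    then have "x * b \<in> ?U" "b * x \<in> ?U" using that(2) by (auto simp: alg_ideal_alg_on)
    then have "x * b \<in> span ?U" "b * x \<in> span ?U" by (auto intro: span_base)
    then show ?case using step.IH
      by (simp add: distrib_left distrib_right scale_mult_left scale_mult_right span_add span_scale)
  qed (simp add: span_zero)
  ultimately show ?thesis by (simp add: alg_ideal_alg_on rad_def)
qed

context
  fixes C I :: "'a set"
  assumes C: "subalgebra C" and I: "alg_ideal I (alg_on C)"
begin

abbreviation coset :: "'a \<Rightarrow> 'a set" where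
  "coset x \<equiv> I +>\<^bsub>alg_on C\<^esub> x"

lemma coset_eq: "coset x = (\<lambda>i. i + x) ` I"
  by (auto simp: a_r_coset_def' alg_on_def)

lemma coset_zero: "coset 0 = I"
  by (simp add: coset_eq)

lemma ideal_facts:
  "I \<subseteq> C" "subspace I" "x \<in> I \<Longrightarrow> b \<in> C \<Longrightarrow> x * b \<in> I" "x \<in> I \<Longrightarrow> b \<in> C \<Longrightarrow> b * x \<in> I"
  using I by (auto simp: alg_ideal_alg_on)

lemma coset_absorb: "i \<in> I \<Longrightarrow> coset (i + x) = coset x"
proof -
  assume i: "i \<in> I"
  have "j + (i + x) \<in> (\<lambda>i. i + x) ` I" if "j \<in> I" for j
    using that i subspace_add[OF ideal_facts(2)]
    by (intro image_eqI[of _ _ "j + i"]) (auto simp: add.assoc)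
  moreover have "j + x \<in> (\<lambda>j. j + (i + x)) ` I" if "j \<in> I" for j
    using that i subspace_diff[OF ideal_facts(2)]
    by (intro image_eqI[of _ _ "j - i"]) auto
  ultimately show ?thesis by (auto simp: coset_eq)
qed

lemma coset_add:
  "coset x \<oplus>\<^bsub>quotient_alg (alg_on C) I\<^esub> coset y = coset (x + y)"
proof -
  have "(i + x) + (j + y) \<in> coset (x + y)" if "i \<in> I" "j \<in> I" for i j
    using that subspace_add[OF ideal_facts(2), of i j]
    by (auto simp: coset_eq image_iff algebra_simps intro!: bexI[of _ "i + j"])
  moreover have sum: "coset x \<oplus>\<^bsub>quotient_alg (alg_on C) I\<^esub> coset y = {a + b | a b. a \<in> coset x \<and> b \<in> coset y}"
    by (auto simp: quotient_alg_def set_add_def' alg_on_def)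
  moreover have "\<exists>a\<in>coset x. \<exists>b\<in>coset y. c = a + b" if "c \<in> coset (x + y)" for c
  proof -
    obtain i where i: "i \<in> I" "c = i + x + y"
      using \<open>c \<in> coset (x + y)\<close> by (auto simp: coset_eq add.assoc)
    have "i + x \<in> coset x" using i by (simp add: coset_eq)
    moreover have "y \<in> coset y" using subspace_0[OF ideal_facts(2)] by (force simp: coset_eq)
    ultimately show ?thesis using i(2) by blast
  qed
  ultimately show ?thesis unfolding sum by (fastforce simp: coset_eq[of x] coset_eq[of y])
qed

lemma coset_mult:
  assumes x: "x \<in> C" and y: "y \<in> C"
  shows "coset x \<otimes>\<^bsub>quotient_alg (alg_on C) I\<^esub> coset y = coset (x * y)"
proof -
  have "coset ((i + x) * (j + y)) = coset (x * y)" if "i \<in> I" "j \<in> I" for i j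
  proof -
    have "j + y \<in> C"
      using that ideal_facts(1) y by (intro subspace_add[OF subspace_subalgebra[OF C]]) auto
    then have "i * (j + y) + x * j \<in> I"
      using that x by (intro subspace_add[OF ideal_facts(2)] ideal_facts(3,4))
    moreover have "(i + x) * (j + y) = (i * (j + y) + x * j) + x * y"
      by (simp add: algebra_simps)
    ultimately show ?thesis using coset_absorb by metis
  qed
  \<comment> \<open>\<open>rcoset_mult\<close> is a union of cosets over all pairs of
    representatives. They are all equal, and the union is that coset only because the index set is
    not empty.\<close>
  moreover have "I \<noteq> {}" using subspace_0[OF ideal_facts(2)] by auto
  moreover have "a \<otimes>\<^bsub>alg_on C\<^esub> b = a * b" for a b by (simp add: alg_on_def)
  ultimately have "rcoset_mult (alg_on C) I (coset x) (coset y) = coset (x * y)"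
    unfolding rcoset_mult_def coset_eq[of x] coset_eq[of y] by simp
  then show ?thesis by (simp add: quotient_alg_def)
qed

lemma quotient_carrier: "carrier (quotient_alg (alg_on C) I) = coset ` C"
  by (auto simp: quotient_alg_def A_RCOSETS_def' alg_on_def)

lemma quotient_zero: "\<zero>\<^bsub>quotient_alg (alg_on C) I\<^esub> = coset 0"
  by (simp add: quotient_alg_def coset_zero)

lemma quotient_nonunital_ring: "nonunital_ring (quotient_alg (alg_on C) I)"
proof -
  note closed = subspace_0[OF subspace_subalgebra[OF C]] subspace_add[OF subspace_subalgebra[OF C]]
    mult_in_subalgebra[OF C]
  interpret abelian_monoid "quotient_alg (alg_on C) I"
    by (intro abelian_monoidI)
      (auto simp: quotient_carrier quotient_zero coset_add closed add_ac)
  show ?thesis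
    by unfold_locales
      (auto simp: quotient_carrier quotient_zero coset_add coset_mult closed algebra_simps)
qed

end

text \<open>On C, \<open>\<rho>\<close> is the composite of the quotient map, the projection to a
  simple component and an isomorphism, all of which respect sums and products. It is not zero
  because a simple component has non-zero products.\<close>

lemma natural_rep_hom:
  assumes C: "subalgebra C" and rep: "natural_rep C n \<rho>"
  shows "\<And>a. a \<in> C \<Longrightarrow> \<rho> a \<in> carrier_mat n n"
    and "\<And>a b. a \<in> C \<Longrightarrow> b \<in> C \<Longrightarrow> \<rho> (a + b) = \<rho> a + \<rho> b"
    and "\<And>a b. a \<in> C \<Longrightarrow> b \<in> C \<Longrightarrow> \<rho> (a * b) = \<rho> a * \<rho> b"
    and "\<exists>a\<in>C. \<rho> a \<noteq> 0\<^sub>m n n"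
proof -
  define I where "I = rad C"
  define Q where "Q = quotient_alg (alg_on C) I"
  note I = rad_ideal[OF C, folded I_def]
  obtain k S i \<phi> where S: "simple_components Q k S" "i < k"
    and \<phi>: "alg_iso \<phi> (Q\<lparr>carrier := S i\<rparr>) (module_mat TYPE('f) n n)"
    and \<rho>: "\<And>b. b \<in> C \<Longrightarrow> \<rho> b = \<phi> (summand_proj Q k S i (I +>\<^bsub>alg_on C\<^esub> b))"
    using rep by (auto simp: natural_rep_def I_def Q_def)
  interpret Q: nonunital_ring Q unfolding Q_def by (rule quotient_nonunital_ring[OF C I])
  have ds: "direct_sum_of_ideals Q k S" using S by (simp add: simple_components_def)
  define \<pi> where "\<pi> b = I +>\<^bsub>alg_on C\<^esub> b" for b
  define P where "P = summand_proj Q k S i"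
  have \<rho>': "\<rho> b = \<phi> (P (\<pi> b))" if "b \<in> C" for b using \<rho>[OF that] by (simp add: P_def \<pi>_def)
  have carr: "carrier Q = \<pi> ` C" unfolding Q_def \<pi>_def by (rule quotient_carrier[OF C I])
  have \<pi>C: "\<pi> b \<in> carrier Q" if "b \<in> C" for b using that carr by simp
  have \<pi>a: "\<pi> (a + b) = \<pi> a \<oplus>\<^bsub>Q\<^esub> \<pi> b" for a b
    unfolding Q_def \<pi>_def by (rule coset_add[OF C I, symmetric])
  have \<pi>m: "\<pi> (a * b) = \<pi> a \<otimes>\<^bsub>Q\<^esub> \<pi> b" if "a \<in> C" "b \<in> C" for a b
    unfolding Q_def \<pi>_def by (rule coset_mult[OF C I that, symmetric])
  have PS: "P x \<in> S i" if "x \<in> carrier Q" for x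
    unfolding P_def by (rule Q.summand_proj_in[OF ds that S(2)])
  have \<phi>b: "bij_betw \<phi> (S i) (carrier_mat n n)" using \<phi> by (simp add: alg_iso_def module_mat_simps)
  have \<phi>a: "\<phi> (x \<oplus>\<^bsub>Q\<^esub> y) = \<phi> x + \<phi> y" and \<phi>m: "\<phi> (x \<otimes>\<^bsub>Q\<^esub> y) = \<phi> x * \<phi> y"
    if "x \<in> S i" "y \<in> S i" for x y
    using \<phi> that by (simp_all add: alg_iso_def module_mat_simps)
  show car: "\<rho> a \<in> carrier_mat n n" if "a \<in> C" for a
    using \<rho>'[OF that] PS[OF \<pi>C[OF that]] \<phi>b by (auto simp: bij_betw_def)
  note closed = subspace_0[OF subspace_subalgebra[OF C]] subspace_add[OF subspace_subalgebra[OF C]]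
    mult_in_subalgebra[OF C]
  show add: "\<rho> (a + b) = \<rho> a + \<rho> b" if "a \<in> C" "b \<in> C" for a b
    using that by (simp add: \<rho>' closed \<pi>a \<phi>a PS \<pi>C P_def[symmetric]
        Q.summand_proj_add[OF ds _ _ S(2), folded P_def])
  show "\<rho> (a * b) = \<rho> a * \<rho> b" if "a \<in> C" "b \<in> C" for a b
    using that by (simp add: \<rho>' closed \<pi>m \<phi>m PS \<pi>C
        Q.summand_proj_mult[OF ds _ _ S(2), folded P_def])
  show "\<exists>a\<in>C. \<rho> a \<noteq> 0\<^sub>m n n"
  proof (rule ccontr)
    assume "\<not> ?thesis"
    then have 0: "\<rho> a = 0\<^sub>m n n" if "a \<in> C" for a using that by auto
    \<comment> \<open>Each element of \<open>S i\<close> is the coset of some \<open>b\<close> in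
      \<open>C\<close> and its own projection, so \<open>\<phi>\<close> takes the value
      \<open>\<rho> b\<close> there. If all these were zero, injectivity of \<open>\<phi>\<close>
      would fail.\<close>
    have \<phi>0: "\<phi> x = 0\<^sub>m n n" if x: "x \<in> S i" for x
    proof -
      have "x \<in> carrier Q" using Q.summand_carrier[OF ds S(2) x] .
      then obtain b where b: "b \<in> C" "x = \<pi> b" using carr by auto
      have "P x = x" unfolding P_def using Q.summand_proj_single[OF ds x S(2) S(2)] by simp
      then show ?thesis using 0[OF b(1)] \<rho>'[OF b(1)] b(2) by simp
    qed
    have "simple_algebra (Q\<lparr>carrier := S i\<rparr>)" using S by (simp add: simple_components_def)
    then obtain x y where xy: "x \<in> S i" "y \<in> S i" "x \<otimes>\<^bsub>Q\<^esub> y \<noteq> \<zero>\<^bsub>Q\<^esub>"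
      by (auto simp: simple_algebra_def)
    have "x \<otimes>\<^bsub>Q\<^esub> y \<in> S i"
      using Q.summand_mult(1)[OF ds S(2) xy(1)] Q.summand_carrier[OF ds S(2) xy(2)] .
    moreover have "\<zero>\<^bsub>Q\<^esub> \<in> S i" by (rule Q.summand_zero[OF ds S(2)])
    ultimately show False
      using \<phi>b xy(3) \<phi>0 by (metis bij_betw_imp_inj_on inj_onD)
  qed
qed

end

section \<open>The local system of algebras generated by an idempotent\<close>

context assoc_algebra
begin

lemma subalgebra_span:
  assumes "\<And>x y. x \<in> X \<Longrightarrow> y \<in> X \<Longrightarrow> x * y \<in> span X"
  shows "subalgebra (span X)"
proof -
  have 1: "x * b \<in> span X" if "x \<in> X" "b \<in> span X" for x b
    using that(2)
  proof (induction rule: span_induct_alt)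
    case (step c y z)
    then show ?case using assms[OF that(1)]
      by (simp add: distrib_left scale_mult_right span_add span_scale)
  qed (simp add: span_zero)
  have "a * b \<in> span X" if "a \<in> span X" "b \<in> span X" for a b
    using that(1)
  proof (induction rule: span_induct_alt)
    case (step c y z)
    then show ?case using 1[OF _ that(2)]
      by (simp add: distrib_right scale_mult_left span_add span_scale)
  qed (simp add: span_zero)
  then show ?thesis by (simp add: subalgebra_def)
qed

text \<open>For an idempotent \<open>e\<close> of a subalgebra B this is B e B, the ideal of B
  generated by \<open>e\<close>.\<close>

definition corner_ideal :: "'a \<Rightarrow> 'a set \<Rightarrow> 'a set" where
  "corner_ideal e B = span {x * e * y | x y. x \<in> B \<and> y \<in> B}"

lemma subspace_corner_ideal: "subspace (corner_ideal e B)"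
  by (simp add: corner_ideal_def)

lemma corner_ideal_mono: "B \<subseteq> B' \<Longrightarrow> corner_ideal e B \<subseteq> corner_ideal e B'"
  unfolding corner_ideal_def by (intro span_mono) blast

lemma corner_ideal_base: "x \<in> B \<Longrightarrow> y \<in> B \<Longrightarrow> x * e * y \<in> corner_ideal e B"
  unfolding corner_ideal_def by (intro span_base) blast

lemma corner_ideal_subset:
  assumes "subalgebra B" "e \<in> B"
  shows "corner_ideal e B \<subseteq> B"
  unfolding corner_ideal_def using assms
  by (intro span_minimal subspace_subalgebra) (auto intro!: mult_in_subalgebra)

lemma corner_ideal_subalgebra:
  assumes B: "subalgebra B" "e \<in> B"
  shows "subalgebra (corner_ideal e B)"
  unfolding corner_ideal_def
proof (rule subalgebra_span)
  fix p q assume "p \<in> {x * e * y | x y. x \<in> B \<and> y \<in> B}" "q \<in> {x * e * y | x y. x \<in> B \<and> y \<in> B}"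
  then obtain x y z w where "p = x * e * y" "q = z * e * w" "x \<in> B" "y \<in> B" "z \<in> B" "w \<in> B"
    by auto
  then have "p * q = x * e * (y * z * e * w)" "y * z * e * w \<in> B"
    using B by (auto simp: mult.assoc intro!: mult_in_subalgebra)
  then show "p * q \<in> span {x * e * y | x y. x \<in> B \<and> y \<in> B}"
    using \<open>x \<in> B\<close> by (intro span_base) auto
qed

lemma corner_ideal_fin_dim:
  assumes "subalgebra B" "e \<in> B" "fin_dim B"
  shows "fin_dim (corner_ideal e B)"
proof -
  obtain X where "finite X" "span X = B" using assms(3) by (auto simp: fin_dim_def)
  then show ?thesis using corner_ideal_subset[OF assms(1,2)]
    by (intro finite_dim_subspace) (auto simp: corner_ideal_def)
qed

text \<open>Each x e y equals (x e) e (e y), whose outer factors already lie in B e B. This is how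
  arbitrary subalgebras produce members of the local system.\<close>

lemma corner_ideal_idem:
  assumes B: "subalgebra B" "e \<in> B" and e: "e * e = e"
  shows "corner_ideal e (corner_ideal e B) = corner_ideal e B"
proof (rule antisym)
  show "corner_ideal e (corner_ideal e B) \<subseteq> corner_ideal e B"
    by (intro corner_ideal_mono corner_ideal_subset B)
  have "x * e * y \<in> corner_ideal e (corner_ideal e B)" if "x \<in> B" "y \<in> B" for x y
  proof -
    have "x * e \<in> corner_ideal e B"
      using corner_ideal_base[OF that(1) B(2), of e] by (simp add: mult.assoc e)
    moreover have "e * y \<in> corner_ideal e B"
      using corner_ideal_base[OF B(2) that(2), of e] by (simp add: e)
    moreover have "x * e * e * (e * y) = x * e * y"
      by (metis e mult.assoc)
    ultimately show ?thesis using corner_ideal_base by metis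
  qed
  then have "{x * e * y | x y. x \<in> B \<and> y \<in> B} \<subseteq> corner_ideal e (corner_ideal e B)" by blast
  from span_minimal[OF this subspace_corner_ideal]
  show "corner_ideal e B \<subseteq> corner_ideal e (corner_ideal e B)"
    by (simp only: corner_ideal_def[of e B, symmetric])
qed

lemma corner_ideal_perfect:
  assumes C: "subalgebra C" "e \<in> C" "corner_ideal e C = C"
  shows "perfect C"
proof -
  have "set_prod C C \<subseteq> C"
    unfolding set_prod_def using C(1)
    by (intro span_minimal subspace_subalgebra) (auto intro: mult_in_subalgebra)
  moreover have "corner_ideal e C \<subseteq> set_prod C C"
    unfolding corner_ideal_def set_prod_def
    using mult_in_subalgebra[OF C(1) _ C(2)] by (intro span_mono) blast
  ultimately show ?thesis using C(3) by (auto simp: perfect_def)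
qed

text \<open>Serves both the simplicity of the least member and the absence of ideals of codimension
  one.\<close>

lemma ideal_eq_if_idempotent_in:
  assumes C: "corner_ideal e C = C" and I: "alg_ideal I (alg_on C)" and e: "e \<in> I"
  shows "I = C"
proof -
  have "corner_ideal e C \<subseteq> I"
    unfolding corner_ideal_def using I e
    by (intro span_minimal) (auto simp: alg_ideal_alg_on)
  then show ?thesis using C I by (auto simp: alg_ideal_alg_on)
qed

end

section \<open>The algebra of 2 by 2 matrices and the subalgebras generated by its
  idempotent\<close>

locale matrix_units = assoc_algebra scale
  for scale :: "'f::field \<Rightarrow> 'a::ring \<Rightarrow> 'a" (infixr \<open>*s\<close> 75) +
  fixes u v :: 'a
  assumes uvu: "u * v * u = u" and vuv: "v * u * v = v" and uu: "u * u = 0" and vv: "v * v = 0"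
    and u0: "u \<noteq> 0"
begin

definition e :: 'a where "e = u * v"

text \<open>The relations in right-nested form, also with a tail \<open>z\<close>, so that together
  with associativity they evaluate words in \<open>u\<close> and \<open>v\<close> by
  rewriting.\<close>

lemma unit_mults:
  "u * (v * u) = u" "u * (v * (u * z)) = u * z" "v * (u * v) = v" "v * (u * (v * z)) = v * z"
  "u * (u * z) = 0" "v * (v * z) = 0"
  by (simp_all add: uvu vuv uu vv mult.assoc[symmetric])

lemmas unit_simps = e_def mult.assoc unit_mults uu vv

lemma e_idem: "e * e = e" by (simp add: unit_simps)

lemma e_nonzero: "e \<noteq> 0"
  using uvu u0 by (auto simp: e_def)

definition S :: "'a set" where "S = span {u * v, u, v, v * u}"

lemma S_subalgebra: "subalgebra S"
  unfolding S_def by (rule subalgebra_span) (auto simp: unit_simps span_zero intro: span_base)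

lemma S_fin_dim: "fin_dim S"
  unfolding S_def fin_dim_def by (rule exI[of _ "{u * v, u, v, v * u}"]) simp

lemma S_contains: "u \<in> S" "v \<in> S" "e \<in> S"
  unfolding S_def e_def by (auto intro: span_base)

lemma S_subset:
  assumes "subalgebra C" "u \<in> C" "v \<in> C"
  shows "S \<subseteq> C"
  unfolding S_def using assms by (intro span_minimal subspace_subalgebra) (auto intro: mult_in_subalgebra)

lemma S_corner: "corner_ideal e S = S"
proof (rule antisym)
  show "corner_ideal e S \<subseteq> S" by (intro corner_ideal_subset S_subalgebra S_contains)
  have "x * e * y \<in> corner_ideal e S" if "x \<in> S" "y \<in> S" for x y
    using that by (rule corner_ideal_base)
  \<comment> \<open>The four products are \<open>e\<close>, \<open>u\<close>, \<open>v\<close> and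
    \<open>v * u\<close>, the spanning set of \<open>S\<close>.\<close>
  from this[of e e] this[of e u] this[of v e] this[of v u]
  show "S \<subseteq> corner_ideal e S"
    using S_contains unfolding S_def corner_ideal_def
    by (intro span_minimal) (auto simp: unit_simps)
qed

lemma S_simple: "simple_algebra (alg_on S)"
proof -
  have "\<exists>x\<in>S. \<exists>y\<in>S. x * y \<noteq> 0" using S_contains(3) e_idem e_nonzero by metis
  moreover have "I = {0} \<or> I = S" if I: "alg_ideal I (alg_on S)" for I
  proof (rule ccontr)
    assume neq: "\<not> ?thesis"
    have Is: "subspace I" "I \<subseteq> S" and Im: "\<And>x b. x \<in> I \<Longrightarrow> b \<in> S \<Longrightarrow> x * b \<in> I \<and> b * x \<in> I"
      using I by (auto simp: alg_ideal_alg_on)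
    obtain x where x: "x \<in> I" "x \<noteq> 0" using neq subspace_0[OF Is(1)] by blast
    have "x \<in> span {u * v, u, v, v * u}" using x(1) Is(2) by (auto simp: S_def)
    then obtain a b c d where abcd: "x - a *s (u * v) - b *s u - c *s v - d *s (v * u) = 0"
      by (auto simp: span_insert)
    have xeq: "x = a *s (u * v) + b *s u + c *s v + d *s (v * u)"
      using abcd by (simp add: algebra_simps)
    \<comment> \<open>Multiplying by matrix units on both sides moves each coefficient of
      \<open>x\<close> to the position of \<open>e\<close>.\<close>
    have "e * x * e = a *s e" "e * x * v = b *s e" "u * x * e = c *s e" "u * x * v = d *s e"
      unfolding xeq by (simp_all add: distrib_left distrib_right scale_mult_left scale_mult_right unit_simps)
    then have "a *s e \<in> I" "b *s e \<in> I" "c *s e \<in> I" "d *s e \<in> I"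
      using Im x(1) S_contains by metis+
    moreover have "a \<noteq> 0 \<or> b \<noteq> 0 \<or> c \<noteq> 0 \<or> d \<noteq> 0" using x(2) xeq by auto
    moreover have "e \<in> I" if "k *s e \<in> I" "k \<noteq> 0" for k
      using subspace_scale[OF Is(1) that(1), of "inverse k"] that(2) by simp
    ultimately have "e \<in> I" by blast
    then show False using ideal_eq_if_idempotent_in[OF S_corner I] neq by simp
  qed
  ultimately show ?thesis unfolding simple_algebra_def by (auto simp: alg_on_def)
qed

text \<open>Modulo an ideal of codimension one, \<open>e\<close> and \<open>u\<close> are multiples
  a and b of one vector, so b e - a u lies in the ideal. As u e = 0, right multiplication by
  \<open>e\<close> leaves b e; if b = 0, then \<open>u\<close> and hence e = u v lie in the
  ideal.\<close>

lemma one_perfect_if_corner: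
  assumes C: "subalgebra C" "u \<in> C" "v \<in> C" "corner_ideal e C = C"
  shows "one_perfect C"
  unfolding one_perfect_def
proof
  assume "\<exists>I. alg_ideal I (alg_on C) \<and> has_codim I C 1"
  then obtain I X where I: "alg_ideal I (alg_on C)"
    and X: "finite X" "card X = 1" "I \<inter> span X = {0}" "span (I \<union> X) = C" "independent X"
    by (auto simp: has_codim_def)
  obtain x where x: "X = {x}" using X(2) by (auto simp: card_1_singleton_iff)
  have Is: "subspace I" and Im: "\<And>x b. x \<in> I \<Longrightarrow> b \<in> C \<Longrightarrow> x * b \<in> I \<and> b * x \<in> I"
    using I by (auto simp: alg_ideal_alg_on)
  have eC: "e \<in> C" using C by (simp add: e_def mult_in_subalgebra)
  have dec: "\<exists>k. y - k *s x \<in> I" if "y \<in> C" for y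
    using that X(4) by (auto simp: x span_insert span_eq_iff[THEN iffD2, OF Is])
  obtain a where a: "e - a *s x \<in> I" using dec eC by blast
  obtain b where b: "u - b *s x \<in> I" using dec C(2) by blast
  have eI: "e \<in> I"
  proof (cases "b = 0")
    case True
    then have "u \<in> I" using b by simp
    then show ?thesis using Im C(3) by (auto simp: e_def)
  next
    case False
    have "b *s (e - a *s x) - a *s (u - b *s x) \<in> I"
      by (intro subspace_diff[OF Is] subspace_scale[OF Is a] subspace_scale[OF Is b])
    moreover have "b *s (e - a *s x) - a *s (u - b *s x) = b *s e - a *s u"
      by (simp add: scale_right_diff_distrib mult.commute)
    ultimately have "(b *s e - a *s u) * e \<in> I" using Im eC by simp
    moreover have "(b *s e - a *s u) * e = b *s e"
      by (simp add: left_diff_distrib scale_mult_left unit_simps)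
    ultimately have "b *s e \<in> I" by simp
    from subspace_scale[OF Is this, of "inverse b"] show ?thesis using False by simp
  qed
  have "I = C" using ideal_eq_if_idempotent_in[OF C(4) I eI] .
  moreover have "x \<in> C" using X(4) x span_base[of x "I \<union> X"] by auto
  ultimately have "x \<in> I \<inter> span X" using x by (auto intro: span_base)
  then have "x = 0" using X(3) by auto
  then show False using X(5) x by (simp add: dependent_zero)
qed

lemma nontrivial_restriction:
  assumes C: "subalgebra C" "u \<in> C" "v \<in> C" "corner_ideal e C = C" and rep: "natural_rep C n \<rho>"
  shows "has_nontrivial_composition_factor S n \<rho>"
proof (rule nontrivial_composition_factorI)
  note hom = natural_rep_hom[OF C(1) rep]
  have eC: "e \<in> C" using C by (simp add: e_def mult_in_subalgebra)
  show "\<rho> a \<in> carrier_mat n n" if "a \<in> S" for a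
    using that S_subset[OF C(1-3)] hom(1) by auto
  show "e \<in> S" by (rule S_contains)
  show "\<rho> e * \<rho> e = \<rho> e" using hom(3)[OF eC eC] e_idem by simp
  show "\<rho> e \<noteq> 0\<^sub>m n n"
  proof
    assume e0: "\<rho> e = 0\<^sub>m n n"
    have 0: "\<rho> 0 = 0\<^sub>m n n"
    proof -
      have z: "0 \<in> C" using C(1) by (simp add: subspace_0 subspace_subalgebra)
      have "\<rho> 0 = \<rho> (0 * e)" by simp
      also have "\<dots> = 0\<^sub>m n n" unfolding hom(3)[OF z eC] e0 using hom(1)[OF z] by simp
      finally show ?thesis .
    qed
    have "\<rho> b = 0\<^sub>m n n" if "b \<in> C" for b
    proof -
      have "b \<in> span {x * e * y | x y. x \<in> C \<and> y \<in> C}"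
        using that C(4) by (simp add: corner_ideal_def)
      then have "b \<in> C \<and> \<rho> b = 0\<^sub>m n n"
      proof (induction rule: span_induct_alt)
        case base
        then show ?case using 0 C(1) by (simp add: subspace_0 subspace_subalgebra)
      next
        case (step c z w)
        then obtain x y where z: "z = x * e * y" "x \<in> C" "y \<in> C" by auto
        \<comment> \<open>The scalar is absorbed into the left factor, because
          \<open>natural_rep_hom\<close> supplies additivity and multiplicativity of
          \<open>\<rho>\<close> but no compatibility with scalars.\<close>
        have cz: "c *s z = (c *s x) * e * y" by (simp add: z scale_mult_left)
        have cx: "c *s x \<in> C" using z C(1) by (simp add: subspace_scale subspace_subalgebra)
        have czC: "c *s z \<in> C" unfolding cz using cx eC z C(1) by (simp add: mult_in_subalgebra)
        have "\<rho> (c *s z) = \<rho> (c *s x) * \<rho> e * \<rho> y"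
          unfolding cz using cx eC z C(1) by (simp add: hom(3) mult_in_subalgebra)
        also have "\<dots> = 0\<^sub>m n n"
          unfolding e0 using hom(1)[OF cx] hom(1)[OF z(3)] by simp
        finally show ?case
          using step czC C(1) by (simp add: hom(2) subspace_add subspace_subalgebra)
      qed
      then show ?thesis by simp
    qed
    then show False using hom(4) by blast
  qed
qed

end

section \<open>Assembly of the conical local system\<close>

theorem theorem5p9:
  fixes scale :: "'f::alg_closed_field \<Rightarrow> 'a::ring \<Rightarrow> 'a"
  assumes "assoc_algebra scale"
    and "assoc_algebra.countably_infinite_dimensional scale"
    and "simple_algebra (assoc_algebra.alg_on scale UNIV)"
    and "assoc_algebra.locally_finite scale"
  shows "\<exists>(\<Gamma> :: 'a set set) (L :: 'a set \<Rightarrow> 'a set).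
           assoc_algebra.conical_local_system scale \<Gamma> L
         \<and> assoc_algebra.one_perfect_local_system scale \<Gamma> L"
proof -
  interpret assoc_algebra scale by fact
  interpret simple_lf_algebra scale by unfold_locales fact+
  obtain u v :: 'a where uv: "u * v * u = u" "v * u * v = v" "u * u = 0" "v * v = 0" "u \<noteq> 0"
    using ex_matrix_units[OF assms(2)] by blast
  interpret matrix_units scale u v by unfold_locales fact+
  define \<Gamma> where "\<Gamma> = {C. subalgebra C \<and> fin_dim C \<and> u \<in> C \<and> v \<in> C \<and> corner_ideal e C = C}"
  have SG: "S \<in> \<Gamma>"
    by (simp add: \<Gamma>_def S_subalgebra S_fin_dim S_contains S_corner)
  have corner: "corner_ideal e B \<in> \<Gamma>" if B: "subalgebra B" "fin_dim B" "u \<in> B" "v \<in> B" for B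
  proof -
    have eB: "e \<in> B" using B by (simp add: e_def mult_in_subalgebra)
    \<comment> \<open>S = S e S lies in B e B, which keeps \<open>u\<close> and \<open>v\<close>
      inside the new member.\<close>
    have "corner_ideal e S \<subseteq> corner_ideal e B"
      using S_subset B by (intro corner_ideal_mono) auto
    then have "u \<in> corner_ideal e B" "v \<in> corner_ideal e B"
      using S_contains by (auto simp: S_corner)
    then show ?thesis
      using B(1,2) eB e_idem
      by (simp add: \<Gamma>_def corner_ideal_subalgebra corner_ideal_fin_dim corner_ideal_idem)
  qed
  have cover: "\<exists>C\<in>\<Gamma>. x \<in> C" for x
  proof -
    have "x \<in> span {a * e * b | a b. True}" using span_sandwich[OF e_nonzero] by simp
    then obtain t where t: "finite t" "t \<subseteq> {a * e * b | a b. True}" "x \<in> span t"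
      by (auto simp: span_explicit)
    have "{a * e * b | a b. True} = range (\<lambda>(a, b). a * e * b)" by (simp add: image_def)
    then obtain D where D: "finite D" "t = (\<lambda>(a, b). a * e * b) ` D"
      using finite_subset_image[OF t(1)] t(2) by metis
    \<comment> \<open>A subalgebra containing the matrix units and all outer factors of the
      expansion of \<open>x\<close> has \<open>x\<close> in B e B.\<close>
    have "finite ({u, v} \<union> (fst ` D \<union> snd ` D))" using D by simp
    then obtain B where B: "subalgebra B" "fin_dim B" "{u, v} \<union> (fst ` D \<union> snd ` D) \<subseteq> B"
      by (rule fin_dim_subalgebra_containing)
    have "t \<subseteq> {a * e * b | a b. a \<in> B \<and> b \<in> B}" using B(3) by (force simp: D)
    then have "x \<in> corner_ideal e B" using t(3) span_mono unfolding corner_ideal_def by blast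
    then show ?thesis using corner[OF B(1,2)] B(3) by blast
  qed
  have directed: "\<exists>C\<in>\<Gamma>. C1 \<subseteq> C \<and> C2 \<subseteq> C" if C12: "C1 \<in> \<Gamma>" "C2 \<in> \<Gamma>" for C1 C2
  proof -
    obtain X1 X2 where X: "finite X1" "span X1 = C1" "finite X2" "span X2 = C2"
      using C12 by (auto simp: \<Gamma>_def fin_dim_def)
    then have "finite (X1 \<union> X2)" by simp
    then obtain B where B: "subalgebra B" "fin_dim B" "X1 \<union> X2 \<subseteq> B"
      by (rule fin_dim_subalgebra_containing)
    have sub: "C1 \<subseteq> B" "C2 \<subseteq> B"
      using B span_minimal[OF _ subspace_subalgebra[OF B(1)]] X(2,4) by blast+
    then have "corner_ideal e B \<in> \<Gamma>" using C12 B by (intro corner) (auto simp: \<Gamma>_def)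
    \<comment> \<open>Each member satisfies C = C e C, so it is contained in B e B as soon as it is
      contained in B.\<close>
    moreover have "C1 \<subseteq> corner_ideal e B" "C2 \<subseteq> corner_ideal e B"
      using corner_ideal_mono[OF sub(1), of e] corner_ideal_mono[OF sub(2), of e] C12
      by (auto simp: \<Gamma>_def)
    ultimately show ?thesis by blast
  qed
  have ls: "local_system \<Gamma> id"
    using cover directed by (auto simp: local_system_def \<Gamma>_def)
  have "conical_local_system \<Gamma> id"
    unfolding conical_local_system_def perfect_local_system_def
  proof (intro conjI bexI[of _ S] ballI allI impI)
    show "perfect (id C)" if "C \<in> \<Gamma>" for C
      using that corner_ideal_perfect[of C e] by (simp add: \<Gamma>_def e_def mult_in_subalgebra)
    show "id S \<subseteq> id C" if "C \<in> \<Gamma>" for C using that S_subset by (simp add: \<Gamma>_def)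
    show "has_nontrivial_composition_factor (id S) n \<rho>"
      if "C \<in> \<Gamma>" "natural_rep (id C) n \<rho>" for C n \<rho>
      using that nontrivial_restriction[of C n \<rho>] by (simp add: \<Gamma>_def)
  qed (use ls S_simple SG in simp_all)
  moreover have "one_perfect_local_system \<Gamma> id"
    using ls one_perfect_if_corner by (simp add: one_perfect_local_system_def \<Gamma>_def)
  ultimately show ?thesis by blast
qed

end
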